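(* There exist a metric space $(V,c)$ (one for each sufficiently large $n=|V|$, with a root $r\in V$) and a constant $\varepsilon_0>0$ such that for any probability distribution $\mathcal{D}$ on tours $\sigma$ of $V$, there exists a set $X\subseteq V$ of size $\Theta(\log n)$ with $$\Pr_{\sigma\leftarrow\mathcal{D}}\left[c(\sigma_X) = o(\log n)\cdot\mathrm{opt}_{TSP}(X)\right] \le \frac{1}{2}\exp(-\varepsilon_0|X|).$$
   Context: A tour $\sigma$ of $V$ is an ordering of the vertices of $V$. For $X\subseteq V$, $\sigma_X$ is the order in which $\sigma$ visits the vertices of $X$, and $c(\sigma_X) := c(r,\sigma_X(1)) + \sum_{i=1}^{|X|-1} c(\sigma_X(i),\sigma_X(i+1)) + c(\sigma_X(|X|),r)$. $\mathrm{opt}_{TSP}(X)$ is the minimum cost of a tour visiting $X\cup\{r\}$. Asymptotics are as $n\to\infty$. *)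

theory Defs
  imports "HOL-Probability.Probability" "HOL-Library.Landau_Symbols"
begin

definition metric_on :: "'a set \<Rightarrow> ('a \<Rightarrow> 'a \<Rightarrow> real) \<Rightarrow> bool" where
  "metric_on V c \<longleftrightarrow>
     (\<forall>x\<in>V. c x x = 0) \<and>
     (\<forall>x\<in>V. \<forall>y\<in>V. x \<noteq> y \<longrightarrow> c x y > 0) \<and>
     (\<forall>x\<in>V. \<forall>y\<in>V. c x y = c y x) \<and>
     (\<forall>x\<in>V. \<forall>y\<in>V. \<forall>z\<in>V. c x z \<le> c x y + c y z)"

definition tours :: "'a set \<Rightarrow> 'a list set" where
  "tours V = {\<sigma>. distinct \<sigma> \<and> set \<sigma> = V}"

definition restrict_tour :: "'a list \<Rightarrow> 'a set \<Rightarrow> 'a list" where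
  "restrict_tour \<sigma> X = filter (\<lambda>v. v \<in> X) \<sigma>"

fun path_cost :: "('a \<Rightarrow> 'a \<Rightarrow> real) \<Rightarrow> 'a list \<Rightarrow> real" where
  "path_cost c (x # y # zs) = c x y + path_cost c (y # zs)"
| "path_cost c _ = 0"

definition tour_cost :: "('a \<Rightarrow> 'a \<Rightarrow> real) \<Rightarrow> 'a \<Rightarrow> 'a list \<Rightarrow> real" where
  "tour_cost c r xs = path_cost c (r # xs @ [r])"

definition opt_tsp :: "('a \<Rightarrow> 'a \<Rightarrow> real) \<Rightarrow> 'a \<Rightarrow> 'a set \<Rightarrow> real" where
  "opt_tsp c r X = Min {tour_cost c r xs | xs. distinct xs \<and> set xs = X}"

end

(* The points are the vertices of the torus Z_m x Z_m, with m about sqrt n, together with isolated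
   padding points. Edges come from the two unit translations and the two elementary shears
   (x, y) |-> (x + y, y) and (x, y) |-> (x, x + y), and c is the graph distance capped at
   k ~ ln n / 20. The set X is the trace of two independent random walks, red and blue, of length k
   from uniform starting points, so opt_TSP(X) <= 5 k.

   Since degrees are bounded, the starting points are with high probability at distance at least 3 k, and
   then every red point is at capped distance k from every blue one. Cut a fixed tour into
   M ~ eta k consecutive blocks: each block met by both walks forces a step of cost k. If only j << M
   blocks are shared, the walks are confined to unions of blocks I and J with |I| + |J| <= M + j, so one
   walk stays inside at most 7/10 of the torus. The torus maps have a spectral gap, so this has
   probability exp(- Omega(k)) for given I and J, which beats the 4^M choices. Averaging over the
   pairs of walks then exchanges the random X and the random tour.

   Spectral gap: if f is almost invariant under the translations, the mass |F|^2 of its Fourier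
   transform sits near 0; if f is also almost invariant under the shears, ping-pong on the cones
   uv >= 0 and uv <= 0 leaves almost no mass outside the origin; but the mass at the origin is at
   most the density of the support of f. *)
theory Submission
  imports Defs "HOL-Real_Asymp.Real_Asymp"
begin

section \<open>Fourier analysis on the discrete torus\<close>

definition periodic :: "int \<Rightarrow> (int \<Rightarrow> 'a) \<Rightarrow> bool" where
  "periodic m h \<longleftrightarrow> (\<forall>x. h (x mod m) = h x)"

lemma sum_periodic_shift:
  fixes h :: "int \<Rightarrow> 'a::comm_monoid_add"
  assumes "periodic m h" "m > 0"
  shows "(\<Sum>x\<in>{0..<m}. h (x + a)) = (\<Sum>x\<in>{0..<m}. h x)"
proof (rule sum.reindex_bij_witness[where i = "\<lambda>x. (x - a) mod m" and j = "\<lambda>x. (x + a) mod m"])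
  fix x assume "x \<in> {0..<m}"
  then show "((x + a) mod m - a) mod m = x" "((x - a) mod m + a) mod m = x"
    using assms by (auto simp: mod_simps)
  show "h ((x + a) mod m) = h (x + a)"
    using assms by (auto simp: periodic_def)
qed (use assms in auto)

text \<open>Frequencies will be taken in a window centred at 0, where the signs of the coordinates,
  and hence the cones, make sense.\<close>

lemma sum_periodic_window:
  fixes h :: "int \<Rightarrow> 'a::comm_monoid_add"
  assumes "periodic m h" "m > 0"
  shows "(\<Sum>x\<in>{-a..<m-a}. h x) = (\<Sum>x\<in>{0..<m}. h x)"
proof -
  have "(\<Sum>x\<in>{-a..<m-a}. h x) = (\<Sum>x\<in>{0..<m}. h (x + (-a)))"
    by (rule sum.reindex_bij_witness[where i = "\<lambda>x. x - a" and j = "\<lambda>x. x + a"]) auto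
  with sum_periodic_shift[OF assms, of "- a"] show ?thesis by simp
qed

section \<open>Characters of Z/m and the one-dimensional Parseval identity\<close>

definition unit_root :: "int \<Rightarrow> int \<Rightarrow> complex" where
  "unit_root m x = cis (2 * pi * of_int x / of_int m)"

lemma unit_root_add: "unit_root m (x + y) = unit_root m x * unit_root m y"
  by (simp add: unit_root_def cis_mult ring_distribs add_divide_distrib)

lemma unit_root_0 [simp]: "unit_root m 0 = 1"
  by (simp add: unit_root_def)

lemma norm_unit_root [simp]: "norm (unit_root m x) = 1"
  by (simp add: unit_root_def)

lemma cnj_unit_root: "cnj (unit_root m x) = unit_root m (- x)"
  by (simp add: unit_root_def cis_cnj)

lemma unit_root_multiple: "m > 0 \<Longrightarrow> unit_root m (m * x) = 1"
  using cis_multiple_2pi[of "of_int x"] by (simp add: unit_root_def mult.assoc)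

lemma unit_root_mod: "m > 0 \<Longrightarrow> unit_root m (x mod m) = unit_root m x"
  using unit_root_add[of m "m * (x div m)" "x mod m"] unit_root_multiple[of m "x div m"] by simp

lemma unit_root_eqI: "m > 0 \<Longrightarrow> x mod m = y mod m \<Longrightarrow> unit_root m x = unit_root m y"
  by (metis unit_root_mod)

lemma unit_root_eq_1_iff:
  assumes "m > 0" shows "unit_root m x = 1 \<longleftrightarrow> m dvd x"
proof
  assume "unit_root m x = 1"
  then have "cos (2 * pi * of_int x / of_int m) = 1"
    by (metis unit_root_def cis.simps(1) one_complex.simps(1))
  then obtain k :: int where "2 * pi * of_int x / of_int m = of_int k * 2 * pi"
    by (auto simp: cos_one_2pi_int)
  then have "real_of_int x = of_int (m * k)" using assms by (simp add: field_simps)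
  then have "x = m * k" by (simp only: of_int_eq_iff)
  then show "m dvd x" by simp
next
  assume "m dvd x" then show "unit_root m x = 1"
    using unit_root_multiple[OF assms] by (auto elim: dvdE)
qed

text \<open>If \<open>m\<close> does not divide \<open>d\<close>, advancing \<open>u\<close> by 1
  leaves the sum unchanged but multiplies it by \<open>unit_root m d\<close>, which differs from 1;
  so the sum vanishes.\<close>

lemma sum_unit_root:
  assumes "m > 0" shows "(\<Sum>u\<in>{0..<m}. unit_root m (u * d)) = (if m dvd d then of_int m else 0)"
proof (cases "m dvd d")
  case True
  then have "unit_root m (u * d) = 1" for u by (simp add: unit_root_eq_1_iff assms)
  then show ?thesis using True assms by simp
next
  case False
  have "periodic m (\<lambda>u. unit_root m (u * d))"
    unfolding periodic_def by (auto intro!: unit_root_eqI assms simp: mod_simps)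
  from sum_periodic_shift[OF this assms, of 1]
  have "unit_root m d * (\<Sum>u\<in>{0..<m}. unit_root m (u * d)) = (\<Sum>u\<in>{0..<m}. unit_root m (u * d))"
    by (simp add: sum_distrib_left unit_root_add ring_distribs mult.commute)
  moreover have "unit_root m d \<noteq> 1" using False assms by (simp add: unit_root_eq_1_iff)
  ultimately show ?thesis using False by simp
qed

text \<open>Expanding the square and summing over \<open>u\<close> first leaves only the diagonal
  terms \<open>x = y\<close>, by orthogonality of the characters.\<close>

lemma parseval_1d:
  fixes a :: "int \<Rightarrow> complex"
  assumes "m > 0"
  shows "(\<Sum>u\<in>{0..<m}. (cmod (\<Sum>x\<in>{0..<m}. a x * unit_root m (u * x)))\<^sup>2)
    = of_int m * (\<Sum>x\<in>{0..<m}. (cmod (a x))\<^sup>2)"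
proof -
  let ?P = "{0..<m}"
  have "complex_of_real (\<Sum>u\<in>?P. (cmod (\<Sum>x\<in>?P. a x * unit_root m (u * x)))\<^sup>2)
    = (\<Sum>u\<in>?P. \<Sum>x\<in>?P. \<Sum>y\<in>?P. a x * cnj (a y) * unit_root m (u * (x - y)))"
    unfolding of_real_sum complex_norm_square cnj_sum sum_product
  proof (intro sum.cong refl)
    fix u x y
    have "unit_root m (u * (x - y)) = unit_root m (u * x) * cnj (unit_root m (u * y))"
      unfolding cnj_unit_root unit_root_add[symmetric] by (simp add: algebra_simps)
    then show "a x * unit_root m (u * x) * cnj (a y * unit_root m (u * y))
        = a x * cnj (a y) * unit_root m (u * (x - y))" by simp
  qed
  also have "\<dots> = (\<Sum>x\<in>?P. \<Sum>y\<in>?P. a x * cnj (a y) * (\<Sum>u\<in>?P. unit_root m (u * (x - y))))"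
    unfolding sum_distrib_left by (subst sum.swap, rule sum.cong[OF refl], subst sum.swap) simp
  also have "\<dots> = (\<Sum>x\<in>?P. \<Sum>y\<in>?P. if x = y then a x * cnj (a x) * of_int m else 0)"
    unfolding sum_unit_root[OF assms]
  proof (intro sum.cong refl)
    fix x y assume "x \<in> ?P" "y \<in> ?P"
    then have "m dvd x - y \<longleftrightarrow> x = y"
      by (metis atLeastLessThan_iff mod_eq_dvd_iff mod_pos_pos_trivial)
    then show "a x * cnj (a y) * (if m dvd x - y then of_int m else 0)
        = (if x = y then a x * cnj (a x) * of_int m else 0)" by auto
  qed
  also have "\<dots> = complex_of_real (of_int m * (\<Sum>x\<in>?P. (cmod (a x))\<^sup>2))"
    unfolding of_real_mult of_real_sum complex_norm_square
    by (simp add: sum_distrib_left mult.commute)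
  finally show ?thesis by (simp only: of_real_eq_iff)
qed

section \<open>The two-dimensional transform and its behaviour under the torus maps\<close>

definition fourier :: "int \<Rightarrow> (int \<Rightarrow> int \<Rightarrow> real) \<Rightarrow> int \<Rightarrow> int \<Rightarrow> complex" where
  "fourier m f u v = (\<Sum>x\<in>{0..<m}. \<Sum>y\<in>{0..<m}. of_real (f x y) * unit_root m (u * x + v * y))"

text \<open>The one-dimensional identity is used twice: in \<open>u\<close> for each fixed
  \<open>v\<close>, then in \<open>v\<close> for each fixed \<open>x\<close>.\<close>

lemma parseval:
  assumes "m > 0"
  shows "(\<Sum>u\<in>{0..<m}. \<Sum>v\<in>{0..<m}. (cmod (fourier m f u v))\<^sup>2)
    = (of_int m)\<^sup>2 * (\<Sum>x\<in>{0..<m}. \<Sum>y\<in>{0..<m}. (f x y)\<^sup>2)"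
proof -
  let ?P = "{0..<m}"
  have "(\<Sum>u\<in>?P. \<Sum>v\<in>?P. (cmod (fourier m f u v))\<^sup>2)
     = (\<Sum>v\<in>?P. \<Sum>u\<in>?P. (cmod (\<Sum>x\<in>?P. (\<Sum>y\<in>?P. of_real (f x y) * unit_root m (v * y)) * unit_root m (u * x)))\<^sup>2)"
    unfolding fourier_def sum_distrib_right
    by (subst sum.swap) (simp add: unit_root_add mult_ac)
  also have "\<dots> = (\<Sum>v\<in>?P. of_int m * (\<Sum>x\<in>?P. (cmod (\<Sum>y\<in>?P. of_real (f x y) * unit_root m (v * y)))\<^sup>2))"
    by (simp add: parseval_1d[OF assms])
  also have "\<dots> = of_int m * (\<Sum>x\<in>?P. \<Sum>v\<in>?P. (cmod (\<Sum>y\<in>?P. of_real (f x y) * unit_root m (v * y)))\<^sup>2)"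
    unfolding sum_distrib_left by (rule sum.swap)
  also have "\<dots> = (of_int m)\<^sup>2 * (\<Sum>x\<in>?P. \<Sum>y\<in>?P. (f x y)\<^sup>2)"
    by (simp only: parseval_1d[OF assms]) (simp add: sum_distrib_left power2_eq_square mult.assoc)
  finally show ?thesis .
qed

text \<open>Functions on the torus are represented as doubly periodic functions on the integer
  plane, so shears and shifts can be written without reduction mod \<open>m\<close>.\<close>

locale periodic_function =
  fixes m :: int and f :: "int \<Rightarrow> int \<Rightarrow> real"
  assumes m_pos: "m > 0"
    and periodic1: "periodic m (\<lambda>x. f x y)"
    and periodic2: "periodic m (f x)"
begin

lemma periodic_character1: "periodic m (\<lambda>x. of_real (f x y) * unit_root m (u * x + w))"
  unfolding periodic_def
proof
  fix x
  have "unit_root m (u * (x mod m) + w) = unit_root m (u * x + w)"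
    by (intro unit_root_eqI[OF m_pos] mod_add_cong mod_mult_right_eq refl)
  moreover have "f (x mod m) y = f x y" using periodic1 by (simp add: periodic_def)
  ultimately show "of_real (f (x mod m) y) * unit_root m (u * (x mod m) + w)
      = of_real (f x y) * unit_root m (u * x + w)" by simp
qed

lemma periodic_character2: "periodic m (\<lambda>y. of_real (f x y) * unit_root m (w + v * y))"
  unfolding periodic_def
proof
  fix y
  have "unit_root m (w + v * (y mod m)) = unit_root m (w + v * y)"
    by (intro unit_root_eqI[OF m_pos] mod_add_cong mod_mult_right_eq refl)
  moreover have "f x (y mod m) = f x y" using periodic2 by (simp add: periodic_def)
  ultimately show "of_real (f x (y mod m)) * unit_root m (w + v * (y mod m))
      = of_real (f x y) * unit_root m (w + v * y)" by simp
qed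

text \<open>Substituting \<open>x - y\<close> for \<open>x\<close> in the inner sum moves the shear
  onto the frequencies, where it acts as its inverse transpose.\<close>

lemma fourier_shear1: "fourier m (\<lambda>x y. f (x + y) y) u v = fourier m f u (v - u)"
proof -
  have "(\<Sum>x\<in>{0..<m}. of_real (f (x + y) y) * unit_root m (u * x + v * y))
      = (\<Sum>x\<in>{0..<m}. of_real (f x y) * unit_root m (u * x + (v - u) * y))" for y
    using sum_periodic_shift[OF periodic_character1[of y u "(v - u) * y"] m_pos, of y]
    by (simp add: algebra_simps)
  then show ?thesis unfolding fourier_def
    by (subst (1 2) sum.swap) simp
qed

lemma fourier_shear2: "fourier m (\<lambda>x y. f x (x + y)) u v = fourier m f (u - v) v"
proof -
  have "(\<Sum>y\<in>{0..<m}. of_real (f x (x + y)) * unit_root m (u * x + v * y))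
      = (\<Sum>y\<in>{0..<m}. of_real (f x y) * unit_root m ((u - v) * x + v * y))" for x
    using sum_periodic_shift[OF periodic_character2[of x "(u - v) * x" v] m_pos, of x]
    by (simp add: algebra_simps)
  then show ?thesis unfolding fourier_def by simp
qed

text \<open>A translation only changes the phase, so the mass of a translation difference is that of
  \<open>f\<close> weighted by the squared distance of \<open>unit_root m (- u)\<close> from
  1.\<close>

lemma fourier_shift1: "fourier m (\<lambda>x y. f (x + 1) y) u v = unit_root m (- u) * fourier m f u v"
proof -
  have "(\<Sum>x\<in>{0..<m}. of_real (f (x + 1) y) * unit_root m (u * x + v * y))
      = (\<Sum>x\<in>{0..<m}. of_real (f x y) * unit_root m (u * x + (v * y - u)))" for y
    using sum_periodic_shift[OF periodic_character1[of y u "v * y - u"] m_pos, of 1]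
    by (simp add: algebra_simps)
  also have "(\<Sum>x\<in>{0..<m}. of_real (f x y) * unit_root m (u * x + (v * y - u)))
      = unit_root m (- u) * (\<Sum>x\<in>{0..<m}. of_real (f x y) * unit_root m (u * x + v * y))" for y
    unfolding sum_distrib_left
    by (intro sum.cong refl) (simp add: unit_root_add[symmetric] algebra_simps)
  finally show ?thesis unfolding fourier_def
    by (subst (1 2) sum.swap) (simp add: sum_distrib_left)
qed

lemma fourier_shift2: "fourier m (\<lambda>x y. f x (y + 1)) u v = unit_root m (- v) * fourier m f u v"
proof -
  have "(\<Sum>y\<in>{0..<m}. of_real (f x (y + 1)) * unit_root m (u * x + v * y))
      = (\<Sum>y\<in>{0..<m}. of_real (f x y) * unit_root m ((u * x - v) + v * y))" for x
    using sum_periodic_shift[OF periodic_character2[of x "u * x - v" v] m_pos, of 1]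
    by (simp add: algebra_simps)
  also have "(\<Sum>y\<in>{0..<m}. of_real (f x y) * unit_root m ((u * x - v) + v * y))
      = unit_root m (- v) * (\<Sum>y\<in>{0..<m}. of_real (f x y) * unit_root m (u * x + v * y))" for x
    unfolding sum_distrib_left
    by (intro sum.cong refl) (simp add: unit_root_add[symmetric] algebra_simps)
  finally show ?thesis unfolding fourier_def
    by (simp add: sum_distrib_left)
qed

end

lemma fourier_diff: "fourier m (\<lambda>x y. f x y - g x y) u v = fourier m f u v - fourier m g u v"
  unfolding fourier_def by (simp add: left_diff_distrib sum_subtractf)

lemma fourier_mod1: "m > 0 \<Longrightarrow> fourier m f (u mod m) v = fourier m f u v"
  unfolding fourier_def
  by (intro sum.cong refl arg_cong2[where f = "(*)"] unit_root_eqI mod_add_cong mod_mult_left_eq)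

lemma fourier_mod2: "m > 0 \<Longrightarrow> fourier m f u (v mod m) = fourier m f u v"
  unfolding fourier_def
  by (intro sum.cong refl arg_cong2[where f = "(*)"] unit_root_eqI mod_add_cong mod_mult_left_eq)

lemma sum_periodic_square:
  fixes h :: "int \<Rightarrow> int \<Rightarrow> 'a::comm_monoid_add"
  assumes "m > 0" and h1: "\<And>u v. h (u mod m) v = h u v" and h2: "\<And>u v. h u (v mod m) = h u v"
  shows "(\<Sum>(u, v)\<in>{-a..<m-a} \<times> {-a..<m-a}. h u v) = (\<Sum>u\<in>{0..<m}. \<Sum>v\<in>{0..<m}. h u v)"
proof -
  have "periodic m (h u)" for u by (simp add: periodic_def h2)
  moreover have "periodic m (\<lambda>u. \<Sum>v\<in>{0..<m}. h u v)" by (simp add: periodic_def h1)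
  ultimately show ?thesis
    by (simp add: sum.cartesian_product[symmetric] sum_periodic_window \<open>m > 0\<close>)
qed

lemma parseval_window:
  assumes "m > 0"
  shows "(\<Sum>(u, v)\<in>{-a..<m-a} \<times> {-a..<m-a}. (cmod (fourier m f u v))\<^sup>2)
    = (of_int m)\<^sup>2 * (\<Sum>x\<in>{0..<m}. \<Sum>y\<in>{0..<m}. (f x y)\<^sup>2)"
  using sum_periodic_square[of m "\<lambda>u v. (cmod (fourier m f u v))\<^sup>2" a] parseval[OF assms]
  by (simp add: assms fourier_mod1 fourier_mod2)

section \<open>Almost invariant masses on the frequency plane\<close>

text \<open>With p, q, s the norms of a, b and a - b, the left side is at most s (p + q); a weighted
  arithmetic-geometric mean inequality splits this product. The weight \<open>e\<close> is later
  balanced between displacement and total mass.\<close>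

lemma abs_diff_square_le:
  fixes a b :: complex
  assumes "e > 0"
  shows "\<bar>(cmod a)\<^sup>2 - (cmod b)\<^sup>2\<bar> \<le> (cmod (a - b))\<^sup>2 / e + e / 2 * ((cmod a)\<^sup>2 + (cmod b)\<^sup>2)"
proof -
  define p q s where "p = cmod a" "q = cmod b" "s = cmod (a - b)"
  have s: "\<bar>p - q\<bar> \<le> s" "0 \<le> p" "0 \<le> q" "0 \<le> s" unfolding p_q_s_def by (auto simp: norm_triangle_ineq3)
  have "\<bar>p\<^sup>2 - q\<^sup>2\<bar> = \<bar>p - q\<bar> * (p + q)"
    using s by (simp add: power2_eq_square square_diff_square_factored abs_mult)
  also have "\<dots> \<le> s * (p + q)" using s by (intro mult_right_mono) auto
  also have "\<dots> \<le> s\<^sup>2 / e + e / 4 * (p + q)\<^sup>2"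
  proof -
    have "0 \<le> (s - e / 2 * (p + q))\<^sup>2 / e" using assms by simp
    also have "\<dots> = s\<^sup>2 / e + e / 4 * (p + q)\<^sup>2 - s * (p + q)"
      using assms by (simp add: power2_eq_square field_simps)
    finally show ?thesis by simp
  qed
  also have "\<dots> \<le> s\<^sup>2 / e + e / 2 * (p\<^sup>2 + q\<^sup>2)"
  proof -
    have "(p + q)\<^sup>2 \<le> 2 * (p\<^sup>2 + q\<^sup>2)"
      using zero_le_power2[of "p - q"] unfolding power2_diff power2_sum by simp
    then have "e / 4 * (p + q)\<^sup>2 \<le> e / 4 * (2 * (p\<^sup>2 + q\<^sup>2))"
      using assms by (intro mult_left_mono) auto
    then show ?thesis by (simp add: algebra_simps)
  qed
  finally show ?thesis unfolding p_q_s_def .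
qed

text \<open>The ping-pong step: two maps sending the cone into disjoint parts of itself double its mass, while almost preserving the measure.\<close>

lemma cone_mass_le:
  fixes \<mu> :: "'b \<Rightarrow> real"
  assumes "finite Q" "K \<subseteq> Q" and nonneg: "\<And>z. \<mu> z \<ge> 0"
    and T: "inj T" "T ` (C \<inter> K) \<subseteq> C \<inter> Q" "(\<Sum>z\<in>Q. \<bar>\<mu> (T z) - \<mu> z\<bar>) \<le> \<delta>"
    and U: "inj U" "U ` (C \<inter> K) \<subseteq> C \<inter> Q" "(\<Sum>z\<in>Q. \<bar>\<mu> (U z) - \<mu> z\<bar>) \<le> \<delta>"
    and disj: "T ` (C \<inter> K) \<inter> U ` (C \<inter> K) = {}"
  shows "sum \<mu> (C \<inter> K) \<le> sum \<mu> (C \<inter> (Q - K)) + 2 * \<delta>"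
proof -
  have fin: "finite (C \<inter> K)" "finite (C \<inter> Q)"
    using assms(1) by (auto intro: finite_subset[OF _ assms(1)] subsetD[OF assms(2)])
  have *: "sum \<mu> (C \<inter> K) - \<delta> \<le> sum \<mu> (S ` (C \<inter> K))" if "inj S" "(\<Sum>z\<in>Q. \<bar>\<mu> (S z) - \<mu> z\<bar>) \<le> \<delta>" for S
  proof -
    have "sum \<mu> (C \<inter> K) - sum \<mu> (S ` (C \<inter> K)) = (\<Sum>z\<in>C \<inter> K. \<mu> z - \<mu> (S z))"
      using that by (subst sum.reindex) (auto simp: sum_subtractf inj_on_def inj_def)
    also have "\<dots> \<le> (\<Sum>z\<in>C \<inter> K. \<bar>\<mu> (S z) - \<mu> z\<bar>)" by (intro sum_mono) auto
    also have "\<dots> \<le> (\<Sum>z\<in>Q. \<bar>\<mu> (S z) - \<mu> z\<bar>)" using assms(1,2) by (intro sum_mono2) auto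
    finally show ?thesis using that by simp
  qed
  have "2 * (sum \<mu> (C \<inter> K) - \<delta>) \<le> sum \<mu> (T ` (C \<inter> K)) + sum \<mu> (U ` (C \<inter> K))"
    using *[OF T(1,3)] *[OF U(1,3)] by simp
  also have "\<dots> = sum \<mu> (T ` (C \<inter> K) \<union> U ` (C \<inter> K))"
    using fin disj by (simp add: sum.union_disjoint)
  also have "\<dots> \<le> sum \<mu> (C \<inter> Q)"
    using fin T U nonneg by (intro sum_mono2) auto
  also have "C \<inter> Q = (C \<inter> K) \<union> (C \<inter> (Q - K))" using assms(2) by auto
  also have "sum \<mu> \<dots> = sum \<mu> (C \<inter> K) + sum \<mu> (C \<inter> (Q - K))"
    using fin assms(1) by (intro sum.union_disjoint) auto
  finally show ?thesis by simp
qed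

text \<open>Each axis, without the origin, goes to one cone only, so that the two cones and the
  origin partition the plane. The half-open choice also keeps the two shear images of a cone apart:
  one coordinate strictly dominates the other in one image, and not in the other image.\<close>

definition pos_cone :: "(int \<times> int) set" where
  "pos_cone = {(u, v). u > 0 \<and> v \<ge> 0 \<or> u < 0 \<and> v \<le> 0}"

definition neg_cone :: "(int \<times> int) set" where
  "neg_cone = {(u, v). u \<le> 0 \<and> v > 0 \<or> u \<ge> 0 \<and> v < 0}"

text \<open>Both coordinates of a point of \<open>K\<close> are below m/4 in absolute value, so one
  shear step cannot leave the window \<open>Q\<close>. Ping-pong in each cone bounds the mass of
  \<open>K\<close> away from the origin by that of \<open>Q - K\<close> plus 4 \<delta>; adding
  \<open>Q - K\<close> itself gives the factor 2.\<close>

lemma plane_mass_le: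
  fixes \<mu> :: "int \<times> int \<Rightarrow> real" and m :: int
  defines "Q \<equiv> {-(m div 2)..<m - m div 2} \<times> {-(m div 2)..<m - m div 2}"
    and "K \<equiv> {(u, v). 4 * \<bar>u\<bar> < m \<and> 4 * \<bar>v\<bar> < m}"
  assumes nonneg: "\<And>z. \<mu> z \<ge> 0" and "m > 0"
    and shears: "(\<Sum>(u, v)\<in>Q. \<bar>\<mu> (u + v, v) - \<mu> (u, v)\<bar>) \<le> \<delta>" "(\<Sum>(u, v)\<in>Q. \<bar>\<mu> (u, u + v) - \<mu> (u, v)\<bar>) \<le> \<delta>"
      "(\<Sum>(u, v)\<in>Q. \<bar>\<mu> (u - v, v) - \<mu> (u, v)\<bar>) \<le> \<delta>" "(\<Sum>(u, v)\<in>Q. \<bar>\<mu> (u, v - u) - \<mu> (u, v)\<bar>) \<le> \<delta>"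
  shows "sum \<mu> Q \<le> \<mu> (0, 0) + 2 * sum \<mu> (Q - K) + 4 * \<delta>"
proof -
  have "finite Q" unfolding Q_def by simp
  have "K \<subseteq> Q" unfolding K_def Q_def using \<open>m > 0\<close> by auto
  have pos: "sum \<mu> (pos_cone \<inter> K) \<le> sum \<mu> (pos_cone \<inter> (Q - K)) + 2 * \<delta>"
  proof (rule cone_mass_le[OF \<open>finite Q\<close> \<open>K \<subseteq> Q\<close> nonneg, where T = "\<lambda>(u, v). (u + v, v)" and U = "\<lambda>(u, v). (u, u + v)"])
    show "(\<lambda>(u, v). (u + v, v)) ` (pos_cone \<inter> K) \<subseteq> pos_cone \<inter> Q"
      "(\<lambda>(u, v). (u, u + v)) ` (pos_cone \<inter> K) \<subseteq> pos_cone \<inter> Q"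
      "(\<lambda>(u, v). (u + v, v)) ` (pos_cone \<inter> K) \<inter> (\<lambda>(u, v). (u, u + v)) ` (pos_cone \<inter> K) = {}"
      unfolding pos_cone_def K_def Q_def by auto
    show "inj (\<lambda>(u, v). (u + v, v) :: int \<times> int)" "inj (\<lambda>(u, v). (u, u + v) :: int \<times> int)"
      by (auto simp: inj_def)
  qed (use shears in \<open>simp_all add: case_prod_unfold\<close>)
  have neg: "sum \<mu> (neg_cone \<inter> K) \<le> sum \<mu> (neg_cone \<inter> (Q - K)) + 2 * \<delta>"
  proof (rule cone_mass_le[OF \<open>finite Q\<close> \<open>K \<subseteq> Q\<close> nonneg, where T = "\<lambda>(u, v). (u - v, v)" and U = "\<lambda>(u, v). (u, v - u)"])
    show "(\<lambda>(u, v). (u - v, v)) ` (neg_cone \<inter> K) \<subseteq> neg_cone \<inter> Q"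
      "(\<lambda>(u, v). (u, v - u)) ` (neg_cone \<inter> K) \<subseteq> neg_cone \<inter> Q"
      "(\<lambda>(u, v). (u - v, v)) ` (neg_cone \<inter> K) \<inter> (\<lambda>(u, v). (u, v - u)) ` (neg_cone \<inter> K) = {}"
      unfolding neg_cone_def K_def Q_def by auto
    show "inj (\<lambda>(u, v). (u - v, v) :: int \<times> int)" "inj (\<lambda>(u, v). (u, v - u) :: int \<times> int)"
      by (auto simp: inj_def)
  qed (use shears in \<open>simp_all add: case_prod_unfold\<close>)
  have fin: "finite K" "finite (Q - K)" using \<open>finite Q\<close> \<open>K \<subseteq> Q\<close> finite_subset by auto
  have split: "sum \<mu> S = sum \<mu> (S \<inter> {(0,0)}) + sum \<mu> (pos_cone \<inter> S) + sum \<mu> (neg_cone \<inter> S)"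
    if "finite S" for S
  proof -
    have "S = (S \<inter> {(0,0)}) \<union> (pos_cone \<inter> S) \<union> (neg_cone \<inter> S)"
      by (auto simp: pos_cone_def neg_cone_def)
    then have "sum \<mu> S = sum \<mu> ((S \<inter> {(0,0)}) \<union> (pos_cone \<inter> S) \<union> (neg_cone \<inter> S))" by simp
    also have "\<dots> = sum \<mu> ((S \<inter> {(0,0)}) \<union> (pos_cone \<inter> S)) + sum \<mu> (neg_cone \<inter> S)"
      using that by (intro sum.union_disjoint) (auto simp: pos_cone_def neg_cone_def)
    also have "sum \<mu> ((S \<inter> {(0,0)}) \<union> (pos_cone \<inter> S)) = sum \<mu> (S \<inter> {(0,0)}) + sum \<mu> (pos_cone \<inter> S)"
      using that by (intro sum.union_disjoint) (auto simp: pos_cone_def)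
    finally show ?thesis .
  qed
  have "K \<inter> {(0,0)} = {(0,0)}" "(Q - K) \<inter> {(0,0)} = {}" using \<open>m > 0\<close> by (auto simp: K_def)
  with split[OF fin(1)] split[OF fin(2)]
  have *: "sum \<mu> K = \<mu> (0,0) + sum \<mu> (pos_cone \<inter> K) + sum \<mu> (neg_cone \<inter> K)"
    "sum \<mu> (Q - K) = sum \<mu> (pos_cone \<inter> (Q - K)) + sum \<mu> (neg_cone \<inter> (Q - K))" by auto
  have "sum \<mu> Q = sum \<mu> (Q - K) + sum \<mu> K"
    by (rule sum.subset_diff[OF \<open>K \<subseteq> Q\<close> \<open>finite Q\<close>])
  with pos neg * show ?thesis by simp
qed

text \<open>The angle lies between a quarter and a half turn, so the real part is at most 0, and the
  squared distance to 1 on the unit circle is 2 minus twice the real part.\<close>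

lemma norm_unit_root_minus_1:
  assumes "m > 0" "2 * \<bar>u\<bar> \<le> m" "4 * \<bar>u\<bar> \<ge> m"
  shows "(cmod (unit_root m (- u) - 1))\<^sup>2 \<ge> 2"
proof -
  define t where "t = 2 * pi * \<bar>of_int u\<bar> / of_int m"
  have "t = pi * (2 * \<bar>of_int u\<bar> / of_int m)" by (simp add: t_def)
  moreover have "2 * \<bar>of_int u\<bar> / of_int m \<le> (1::real)" "2 * \<bar>of_int u\<bar> / of_int m \<ge> (1/2::real)"
    using assms by (auto simp: field_simps)
  ultimately have t: "pi / 2 \<le> t" "t \<le> pi"
    using mult_left_mono[of "1/2" "2 * \<bar>of_int u\<bar> / of_int m" pi]
      mult_left_mono[of "2 * \<bar>of_int u\<bar> / of_int m" 1 pi] by simp_all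
  then have "cos t \<le> 0" using cos_monotone_0_pi_le[of "pi/2" t] by simp
  moreover have "cos (2 * pi * of_int (- u) / of_int m) = cos t"
    by (cases "u \<ge> 0") (simp_all add: t_def)
  ultimately have "Re (unit_root m (- u)) \<le> 0" by (simp add: unit_root_def)
  moreover have "(cmod (unit_root m (- u) - 1))\<^sup>2 = 2 - 2 * Re (unit_root m (- u))"
  proof -
    have "(Re (unit_root m (- u)))\<^sup>2 + (Im (unit_root m (- u)))\<^sup>2 = 1"
      using norm_unit_root[of m "- u"] by (metis cmod_power2 one_power2)
    then show ?thesis by (simp add: cmod_power2 power2_diff)
  qed
  ultimately show ?thesis by simp
qed

section \<open>The spectral gap in energy form\<close>

context periodic_function begin

definition energy :: "(int \<Rightarrow> int \<Rightarrow> real) \<Rightarrow> real" where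
  "energy h = (\<Sum>x\<in>{0..<m}. \<Sum>y\<in>{0..<m}. (h x y)\<^sup>2)"

abbreviation window :: "(int \<times> int) set" where
  "window \<equiv> {-(m div 2)..<m - m div 2} \<times> {-(m div 2)..<m - m div 2}"

lemma parseval_energy:
  "(\<Sum>(u, v)\<in>window. (cmod (fourier m h u v))\<^sup>2) = (of_int m)\<^sup>2 * energy h"
  unfolding energy_def by (rule parseval_window[OF m_pos])

text \<open>Sum \<open>abs_diff_square_le\<close> over the window and apply Parseval: for a
  displacement of relative size \<open>e\<close> in norm, both terms contribute \<open>e\<close>
  times the total mass.\<close>

lemma fourier_mass_diff_le:
  assumes "e > 0" and "energy g = energy f"
    and "energy (\<lambda>x y. g x y - f x y) \<le> e\<^sup>2 * energy f"
  shows "(\<Sum>(u, v)\<in>window. \<bar>(cmod (fourier m g u v))\<^sup>2 - (cmod (fourier m f u v))\<^sup>2\<bar>)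
    \<le> 2 * e * ((of_int m)\<^sup>2 * energy f)"
proof -
  have "(\<Sum>(u, v)\<in>window. \<bar>(cmod (fourier m g u v))\<^sup>2 - (cmod (fourier m f u v))\<^sup>2\<bar>)
    \<le> (\<Sum>z\<in>window. (case z of (u, v) \<Rightarrow> (cmod (fourier m (\<lambda>x y. g x y - f x y) u v))\<^sup>2) / e
        + e / 2 * ((case z of (u, v) \<Rightarrow> (cmod (fourier m g u v))\<^sup>2)
                + (case z of (u, v) \<Rightarrow> (cmod (fourier m f u v))\<^sup>2)))"
    using abs_diff_square_le[OF assms(1)] by (intro sum_mono) (auto simp: fourier_diff)
  also have "\<dots> = (of_int m)\<^sup>2 * energy (\<lambda>x y. g x y - f x y) / e
      + e / 2 * ((of_int m)\<^sup>2 * energy g + (of_int m)\<^sup>2 * energy f)"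
    unfolding parseval_energy[symmetric]
    by (simp only: sum.distrib sum_distrib_left[symmetric] sum_divide_distrib[symmetric])
  also have "\<dots> \<le> (of_int m)\<^sup>2 * (e\<^sup>2 * energy f) / e + e / 2 * (2 * ((of_int m)\<^sup>2 * energy f))"
    unfolding assms(2) using assms(1,3)
    by (intro add_mono divide_right_mono mult_left_mono) auto
  also have "\<dots> = 2 * e * ((of_int m)\<^sup>2 * energy f)"
    using assms(1) by (simp add: field_simps power2_eq_square)
  finally show ?thesis .
qed

lemma energy_shear1: "energy (\<lambda>x y. f (x + y) y) = energy f"
proof -
  have "(\<Sum>x\<in>{0..<m}. (f (x + y) y)\<^sup>2) = (\<Sum>x\<in>{0..<m}. (f x y)\<^sup>2)" for y
    using periodic1 by (intro sum_periodic_shift[where h = "\<lambda>x. (f x y)\<^sup>2"] m_pos) (simp add: periodic_def)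
  then show ?thesis unfolding energy_def by (subst (1 2) sum.swap) simp
qed

lemma energy_shear2: "energy (\<lambda>x y. f x (x + y)) = energy f"
proof -
  have "(\<Sum>y\<in>{0..<m}. (f x (y + x))\<^sup>2) = (\<Sum>y\<in>{0..<m}. (f x y)\<^sup>2)" for x
    using periodic2 by (intro sum_periodic_shift[where h = "\<lambda>y. (f x y)\<^sup>2"] m_pos) (simp add: periodic_def)
  then show ?thesis unfolding energy_def by (simp add: add.commute)
qed

text \<open>The transform yields the shears that subtract, which fit the negative cone. Re-indexing
  by \<open>u + v\<close> exchanges a shear with its inverse and so provides the ones that add, for
  the positive cone.\<close>

lemma sum_shear_window1:
  fixes h :: "int \<Rightarrow> int \<Rightarrow> real"
  assumes "\<And>u v. h (u mod m) v = h u v" "\<And>u v. h u (v mod m) = h u v"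
  shows "(\<Sum>(u, v)\<in>window. \<bar>h (u + v) v - h u v\<bar>) = (\<Sum>(u, v)\<in>window. \<bar>h (u - v) v - h u v\<bar>)"
proof -
  have per: "periodic m (\<lambda>u. \<bar>h (u - v) v - h u v\<bar>)" for v
    unfolding periodic_def using assms by (metis mod_diff_left_eq)
  have "(\<Sum>u\<in>{0..<m}. \<bar>h (u + v) v - h u v\<bar>) = (\<Sum>u\<in>{0..<m}. \<bar>h (u - v) v - h u v\<bar>)" for v
    using sum_periodic_shift[OF per m_pos, of v v] by (simp add: abs_minus_commute)
  then have "(\<Sum>u\<in>{0..<m}. \<Sum>v\<in>{0..<m}. \<bar>h (u + v) v - h u v\<bar>)
      = (\<Sum>u\<in>{0..<m}. \<Sum>v\<in>{0..<m}. \<bar>h (u - v) v - h u v\<bar>)"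
    by (subst (1 2) sum.swap) simp
  moreover have "(\<Sum>(u, v)\<in>window. \<bar>h (u + v) v - h u v\<bar>) = (\<Sum>u\<in>{0..<m}. \<Sum>v\<in>{0..<m}. \<bar>h (u + v) v - h u v\<bar>)"
    by (rule sum_periodic_square[OF m_pos]) (metis assms mod_add_left_eq mod_add_right_eq)+
  moreover have "(\<Sum>(u, v)\<in>window. \<bar>h (u - v) v - h u v\<bar>) = (\<Sum>u\<in>{0..<m}. \<Sum>v\<in>{0..<m}. \<bar>h (u - v) v - h u v\<bar>)"
    by (rule sum_periodic_square[OF m_pos]) (metis assms mod_diff_left_eq mod_diff_right_eq)+
  ultimately show ?thesis by simp
qed

lemma sum_shear_window2:
  fixes h :: "int \<Rightarrow> int \<Rightarrow> real"
  assumes "\<And>u v. h (u mod m) v = h u v" "\<And>u v. h u (v mod m) = h u v"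
  shows "(\<Sum>(u, v)\<in>window. \<bar>h u (u + v) - h u v\<bar>) = (\<Sum>(u, v)\<in>window. \<bar>h u (v - u) - h u v\<bar>)"
proof -
  have swap: "(\<Sum>(u, v)\<in>window. g u v) = (\<Sum>(u, v)\<in>window. g v u)" for g :: "int \<Rightarrow> int \<Rightarrow> real"
    unfolding sum.cartesian_product[symmetric] by (rule sum.swap)
  show ?thesis
    using sum_shear_window1[of "\<lambda>u v. h v u"] assms
    by (subst (1 2) swap) (simp add: add.commute)
qed

text \<open>Outside the central square one coordinate is at least m/4 in absolute value, so one of
  the two translation weights is at least 2 there; Parseval turns the weighted mass into
  displacement energy.\<close>

lemma fourier_tail_le:
  "2 * (\<Sum>(u, v)\<in>window - {(u, v). 4 * \<bar>u\<bar> < m \<and> 4 * \<bar>v\<bar> < m}. (cmod (fourier m f u v))\<^sup>2)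
    \<le> (of_int m)\<^sup>2 * (energy (\<lambda>x y. f (x + 1) y - f x y) + energy (\<lambda>x y. f x (y + 1) - f x y))"
proof -
  let ?K = "{(u, v). 4 * \<bar>u\<bar> < m \<and> 4 * \<bar>v\<bar> < m}"
  let ?F = "fourier m f"
  let ?b1 = "\<lambda>u. (cmod (unit_root m (- u) - 1))\<^sup>2"
  have F1: "(cmod (fourier m (\<lambda>x y. f (x + 1) y - f x y) u v))\<^sup>2 = ?b1 u * (cmod (?F u v))\<^sup>2" for u v
  proof -
    have "fourier m (\<lambda>x y. f (x + 1) y - f x y) u v = (unit_root m (- u) - 1) * ?F u v"
      unfolding fourier_diff fourier_shift1 by (simp add: algebra_simps)
    then show ?thesis by (simp add: norm_mult power_mult_distrib)
  qed
  have F2: "(cmod (fourier m (\<lambda>x y. f x (y + 1) - f x y) u v))\<^sup>2 = ?b1 v * (cmod (?F u v))\<^sup>2" for u v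
  proof -
    have "fourier m (\<lambda>x y. f x (y + 1) - f x y) u v = (unit_root m (- v) - 1) * ?F u v"
      unfolding fourier_diff fourier_shift2 by (simp add: algebra_simps)
    then show ?thesis by (simp add: norm_mult power_mult_distrib)
  qed
  have "2 * (\<Sum>(u, v)\<in>window - ?K. (cmod (?F u v))\<^sup>2)
      = (\<Sum>(u, v)\<in>window - ?K. 2 * (cmod (?F u v))\<^sup>2)"
    by (simp add: sum_distrib_left case_prod_unfold)
  also have "\<dots> \<le> (\<Sum>(u, v)\<in>window - ?K. (?b1 u + ?b1 v) * (cmod (?F u v))\<^sup>2)"
  proof (rule sum_mono)
    fix z assume "z \<in> window - ?K"
    moreover obtain u v where "z = (u, v)" by (cases z)
    ultimately have z: "z = (u, v)" "u \<in> {-(m div 2)..<m - m div 2}" "v \<in> {-(m div 2)..<m - m div 2}"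
      "(u, v) \<notin> ?K" by blast+
    then have le: "2 * \<bar>u\<bar> \<le> m" "2 * \<bar>v\<bar> \<le> m" by auto
    have "4 * \<bar>u\<bar> \<ge> m \<or> 4 * \<bar>v\<bar> \<ge> m" using z by auto
    then have "?b1 u \<ge> 2 \<or> ?b1 v \<ge> 2"
      using norm_unit_root_minus_1[OF m_pos] le by blast
    moreover have "?b1 u \<ge> 0" "?b1 v \<ge> 0" by auto
    ultimately have "?b1 u + ?b1 v \<ge> 2" by linarith
    then have "2 * (cmod (?F u v))\<^sup>2 \<le> (?b1 u + ?b1 v) * (cmod (?F u v))\<^sup>2"
      by (rule mult_right_mono) simp
    then show "(case z of (u, v) \<Rightarrow> 2 * (cmod (?F u v))\<^sup>2)
        \<le> (case z of (u, v) \<Rightarrow> (?b1 u + ?b1 v) * (cmod (?F u v))\<^sup>2)" by (simp add: z)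
  qed
  also have "\<dots> \<le> (\<Sum>(u, v)\<in>window. (?b1 u + ?b1 v) * (cmod (?F u v))\<^sup>2)"
    by (intro sum_mono2) auto
  also have "\<dots> = (\<Sum>(u, v)\<in>window. (cmod (fourier m (\<lambda>x y. f (x + 1) y - f x y) u v))\<^sup>2)
      + (\<Sum>(u, v)\<in>window. (cmod (fourier m (\<lambda>x y. f x (y + 1) - f x y) u v))\<^sup>2)"
    unfolding F1 F2 by (simp add: case_prod_unfold sum.distrib distrib_right)
  finally show ?thesis unfolding parseval_energy by (simp add: distrib_left)
qed

text \<open>The transform at frequency 0 is the sum of \<open>f\<close>; Cauchy-Schwarz is applied
  over the support only.\<close>

lemma fourier_0_le:
  assumes "real (card {z \<in> {0..<m} \<times> {0..<m}. f (fst z) (snd z) \<noteq> 0}) \<le> \<beta>"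
  shows "(cmod (fourier m f 0 0))\<^sup>2 \<le> \<beta> * energy f"
proof -
  let ?S = "{z \<in> {0..<m} \<times> {0..<m}. f (fst z) (snd z) \<noteq> 0}"
  have "fourier m f 0 0 = of_real (\<Sum>z\<in>{0..<m} \<times> {0..<m}. f (fst z) (snd z))"
    by (simp add: fourier_def sum.cartesian_product case_prod_unfold)
  also have "(\<Sum>z\<in>{0..<m} \<times> {0..<m}. f (fst z) (snd z)) = (\<Sum>z\<in>?S. f (fst z) (snd z) * 1)"
    by (intro sum.mono_neutral_cong_right) auto
  finally have "(cmod (fourier m f 0 0))\<^sup>2 = (\<Sum>z\<in>?S. f (fst z) (snd z) * 1)\<^sup>2"
    by (simp only: norm_of_real power2_abs)
  also have "\<dots> \<le> (\<Sum>z\<in>?S. (f (fst z) (snd z))\<^sup>2) * (\<Sum>z\<in>?S. 1\<^sup>2)"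
    by (rule Cauchy_Schwarz_ineq_sum)
  also have "\<dots> = energy f * real (card ?S)"
  proof -
    have "energy f = (\<Sum>z\<in>{0..<m} \<times> {0..<m}. (f (fst z) (snd z))\<^sup>2)"
      by (simp add: energy_def sum.cartesian_product case_prod_unfold)
    also have "\<dots> = (\<Sum>z\<in>?S. (f (fst z) (snd z))\<^sup>2)"
      by (intro sum.mono_neutral_cong_right) auto
    finally show ?thesis by simp
  qed
  also have "\<dots> \<le> energy f * \<beta>"
    using assms by (intro mult_left_mono) (auto simp: energy_def intro!: sum_nonneg)
  finally show ?thesis by (simp add: mult.commute)
qed

text \<open>Since 1/900 is the square of 1/30, each shear moves at most 2/30 of the total mass
  \<open>Z\<close>. The plane estimate then gives Z <= (7/10 + 2/900 + 8/30) Z, whose factor is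
  below 1.\<close>

lemma energy_gap:
  assumes supp: "real (card {z \<in> {0..<m} \<times> {0..<m}. f (fst z) (snd z) \<noteq> 0}) \<le> 7/10 * (of_int m)\<^sup>2"
    and small: "energy (\<lambda>x y. f (x + 1) y - f x y) \<le> energy f / 900"
      "energy (\<lambda>x y. f x (y + 1) - f x y) \<le> energy f / 900"
      "energy (\<lambda>x y. f (x + y) y - f x y) \<le> energy f / 900"
      "energy (\<lambda>x y. f x (x + y) - f x y) \<le> energy f / 900"
  shows "energy f = 0"
proof -
  define Z where "Z = (of_int m)\<^sup>2 * energy f"
  define \<mu> where "\<mu> = (\<lambda>(u, v). (cmod (fourier m f u v))\<^sup>2)"
  let ?K = "{(u, v). 4 * \<bar>u\<bar> < m \<and> 4 * \<bar>v\<bar> < m}"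
  have "energy f \<ge> 0" by (auto simp: energy_def intro!: sum_nonneg)
  have mass: "sum \<mu> window = Z" using parseval_energy[of f] by (simp add: \<mu>_def Z_def)
  have s1: "(\<Sum>(u, v)\<in>window. \<bar>\<mu> (u, v - u) - \<mu> (u, v)\<bar>) \<le> 2 * (1/30) * Z"
    using fourier_mass_diff_le[of "1/30", OF _ energy_shear1] small(3)
    by (simp add: \<mu>_def Z_def fourier_shear1 power2_eq_square)
  have s2: "(\<Sum>(u, v)\<in>window. \<bar>\<mu> (u - v, v) - \<mu> (u, v)\<bar>) \<le> 2 * (1/30) * Z"
    using fourier_mass_diff_le[of "1/30", OF _ energy_shear2] small(4)
    by (simp add: \<mu>_def Z_def fourier_shear2 power2_eq_square)
  have s3: "(\<Sum>(u, v)\<in>window. \<bar>\<mu> (u + v, v) - \<mu> (u, v)\<bar>) \<le> 2 * (1/30) * Z"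
    using sum_shear_window1[of "\<lambda>u v. \<mu> (u, v)"] s2 by (simp add: \<mu>_def fourier_mod1 fourier_mod2 m_pos)
  have s4: "(\<Sum>(u, v)\<in>window. \<bar>\<mu> (u, u + v) - \<mu> (u, v)\<bar>) \<le> 2 * (1/30) * Z"
    using sum_shear_window2[of "\<lambda>u v. \<mu> (u, v)"] s1 by (simp add: \<mu>_def fourier_mod1 fourier_mod2 m_pos)
  have "sum \<mu> window \<le> \<mu> (0, 0) + 2 * sum \<mu> (window - ?K) + 4 * (2 * (1/30) * Z)"
    by (rule plane_mass_le[OF _ m_pos s3 s4 s2 s1]) (auto simp: \<mu>_def)
  moreover have "\<mu> (0, 0) \<le> 7/10 * Z"
    using fourier_0_le[OF supp] by (simp add: \<mu>_def Z_def)
  moreover have "2 * sum \<mu> (window - ?K) \<le> 2 / 900 * Z"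
  proof -
    have "2 * sum \<mu> (window - ?K)
        \<le> (of_int m)\<^sup>2 * (energy (\<lambda>x y. f (x + 1) y - f x y) + energy (\<lambda>x y. f x (y + 1) - f x y))"
      using fourier_tail_le by (simp add: \<mu>_def)
    also have "\<dots> \<le> (of_int m)\<^sup>2 * (energy f / 900 + energy f / 900)"
      using small(1,2) by (intro mult_left_mono add_mono) auto
    finally show ?thesis by (simp add: Z_def)
  qed
  ultimately have "Z \<le> 0" using mass by simp
  then show ?thesis using \<open>energy f \<ge> 0\<close> m_pos by (simp add: Z_def mult_le_0_iff)
qed

end

section \<open>Random walks on the torus\<close>

text \<open>The number \<open>v\<close> encodes the point \<open>(v div m, v mod m)\<close>. Keeping the identity among the maps (any index other than 1 to 4) makes the walk lazy: averaging contracts \<open>f\<close> as soon as one generator displaces it.\<close>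

definition torus_map :: "nat \<Rightarrow> nat \<Rightarrow> nat \<Rightarrow> nat" where
  "torus_map m g v =
    (let x = v div m; y = v mod m in
     if g = 1 then (x + 1) mod m * m + y
     else if g = 2 then x * m + (y + 1) mod m
     else if g = 3 then (x + y) mod m * m + y
     else if g = 4 then x * m + (x + y) mod m
     else v)"

lemma torus_map_0 [simp]: "torus_map m 0 v = v"
  by (simp add: torus_map_def)

lemma torus_code_less:
  fixes a b m :: nat
  assumes "a < m" "b < m" shows "a * m + b < m * m"
proof -
  have "a * m + b < (a + 1) * m" using assms by simp
  also have "\<dots> \<le> m * m" using assms by (intro mult_right_mono) auto
  finally show ?thesis .
qed

lemma torus_map_less: "v < m * m \<Longrightarrow> torus_map m g v < m * m"
proof -
  assume v: "v < m * m"
  then have "m > 0" by (cases m) auto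
  with v show ?thesis
    by (auto simp: torus_map_def Let_def less_mult_imp_div_less intro!: torus_code_less)
qed

lemma mod_add_right_cancel_nat:
  fixes x y a m :: nat
  assumes "(x + a) mod m = (y + a) mod m" "x < m" "y < m"
  shows "x = y"
  using assms
proof (induction x y rule: linorder_wlog)
  case (le x y)
  then have "m dvd (y + a) - (x + a)" by (metis add_le_cancel_right mod_eq_dvd_iff_nat)
  then have "m dvd y - x" by simp
  moreover have "y - x < m" using le by simp
  ultimately have "y - x = 0" by (meson dvd_imp_le linorder_not_le not_gr_zero)
  with le show ?case by simp
qed auto

lemma torus_code_inject:
  fixes a b a' b' m :: nat
  assumes "a * m + b = a' * m + b'" "b < m" "b' < m"
  shows "a = a' \<and> b = b'"
proof -
  have "(a * m + b) div m = a" "(a' * m + b') div m = a'" "(a * m + b) mod m = b" "(a' * m + b') mod m = b'"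
    using assms(2,3) by auto
  with assms(1) show ?thesis by metis
qed

text \<open>On a finite set injectivity suffices. Each nontrivial map changes one coordinate: the
  other is decoded first, and then the changed one cancels mod \<open>m\<close>.\<close>

lemma bij_torus_map: "bij_betw (torus_map m g) {..<m * m} {..<m * m}"
proof -
  have "inj_on (torus_map m g) {..<m * m}"
  proof (rule inj_onI)
    fix v w assume vw: "v \<in> {..<m * m}" "w \<in> {..<m * m}" and eq: "torus_map m g v = torus_map m g w"
    then have "m > 0" by (cases m) auto
    define x y x' y' where xy: "x = v div m" "y = v mod m" "x' = w div m" "y' = w mod m"
    have less: "x < m" "y < m" "x' < m" "y' < m"
      using vw \<open>m > 0\<close> by (auto simp: xy less_mult_imp_div_less)
    have mod: "a mod m < m" for a using \<open>m > 0\<close> by simp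
    have map: "torus_map m g v = (if g = 1 then (x + 1) mod m * m + y else if g = 2 then x * m + (y + 1) mod m
        else if g = 3 then (x + y) mod m * m + y else if g = 4 then x * m + (y + x) mod m else x * m + y)"
      "torus_map m g w = (if g = 1 then (x' + 1) mod m * m + y' else if g = 2 then x' * m + (y' + 1) mod m
        else if g = 3 then (x' + y') mod m * m + y' else if g = 4 then x' * m + (y' + x') mod m else x' * m + y')"
      by (simp_all add: torus_map_def Let_def xy add.commute)
    have "x = x' \<and> y = y'"
    proof -
      consider "g = 1" | "g = 2" | "g = 3" | "g = 4" | "g \<notin> {1, 2, 3, 4}" by blast
      then show ?thesis
      proof cases
        case 1
        with eq have "(x + 1) mod m * m + y = (x' + 1) mod m * m + y'" unfolding map by simp
        from torus_code_inject[OF this less(2,4)] show ?thesis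
          using mod_add_right_cancel_nat[of x 1 m x'] less by blast
      next
        case 2
        with eq have "x * m + (y + 1) mod m = x' * m + (y' + 1) mod m" unfolding map by simp
        from torus_code_inject[OF this mod mod] show ?thesis
          using mod_add_right_cancel_nat[of y 1 m y'] less by blast
      next
        case 3
        with eq have "(x + y) mod m * m + y = (x' + y') mod m * m + y'" unfolding map by simp
        from torus_code_inject[OF this less(2,4)] show ?thesis
          using mod_add_right_cancel_nat[of x y m x'] less by blast
      next
        case 4
        with eq have "x * m + (y + x) mod m = x' * m + (y' + x') mod m" unfolding map by simp
        from torus_code_inject[OF this mod mod] show ?thesis
          using mod_add_right_cancel_nat[of y x m y'] less by blast
      next
        case 5
        with eq have "x * m + y = x' * m + y'" unfolding map by simp
        from torus_code_inject[OF this less(2,4)] show ?thesis .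
      qed
    qed
    then show "v = w" unfolding xy by (metis div_mult_mod_eq)
  qed
  then show ?thesis
    by (intro bij_betw_imageI endo_inj_surj) (auto simp: torus_map_less)
qed

section \<open>Transfer of the gap to the coded torus\<close>

lemma sum_torus:
  fixes h :: "nat \<Rightarrow> real"
  assumes "m > 0"
  shows "(\<Sum>v<m * m. h v) = (\<Sum>x\<in>{0..<int m}. \<Sum>y\<in>{0..<int m}. h (nat x * m + nat y))"
proof -
  have "(\<Sum>v<m * m. h v) = (\<Sum>z\<in>{0..<int m} \<times> {0..<int m}. h (nat (fst z) * m + nat (snd z)))"
  proof (rule sum.reindex_bij_witness[where i = "\<lambda>z. nat (fst z) * m + nat (snd z)"
        and j = "\<lambda>v. (int (v div m), int (v mod m))"])
    fix z assume "z \<in> {0..<int m} \<times> {0..<int m}"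
    then have "nat (fst z) < m" "nat (snd z) < m" "0 \<le> fst z" "0 \<le> snd z" by auto
    then show "(int ((nat (fst z) * m + nat (snd z)) div m), int ((nat (fst z) * m + nat (snd z)) mod m)) = z"
      "nat (fst z) * m + nat (snd z) \<in> {..<m * m}"
      by (auto simp: torus_code_less)
  qed (use assms in \<open>auto simp: less_mult_imp_div_less simp flip: of_nat_mod of_nat_div\<close>)
  then show ?thesis by (simp add: sum.cartesian_product case_prod_unfold)
qed

text \<open>The defect in Cauchy-Schwarz is five times the sum of squared deviations from the mean,
  and the two entries 0 and \<open>g\<close> alone account for half of their squared difference.
  Entry 0 will be the identity map.\<close>

lemma square_sum_le:
  fixes a :: "nat \<Rightarrow> real"
  assumes "g < 5"
  shows "(\<Sum>i<5. a i)\<^sup>2 + (a g - a 0)\<^sup>2 \<le> 5 * (\<Sum>i<5. (a i)\<^sup>2)"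
proof -
  define c where "c = (\<Sum>i<5. a i) / 5"
  have "(\<Sum>i<5. (a i - c)\<^sup>2) = (\<Sum>i<5. (a i)\<^sup>2) - 2 * c * (\<Sum>i<5. a i) + 5 * c\<^sup>2"
    by (simp add: power2_diff sum.distrib sum_subtractf sum_distrib_left mult_ac)
  then have var: "5 * (\<Sum>i<5. (a i - c)\<^sup>2) = 5 * (\<Sum>i<5. (a i)\<^sup>2) - (\<Sum>i<5. a i)\<^sup>2"
    by (simp add: c_def power2_eq_square)
  show ?thesis
  proof (cases "g = 0")
    case True
    have "0 \<le> (\<Sum>i<5. (a i - c)\<^sup>2)" by (intro sum_nonneg) auto
    with True var show ?thesis by simp
  next
    case False
    have "(a g - a 0)\<^sup>2 \<le> 2 * ((a 0 - c)\<^sup>2 + (a g - c)\<^sup>2)"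
      using zero_le_power2[of "a 0 + a g - 2 * c"] by (simp add: power2_eq_square algebra_simps)
    also have "(a 0 - c)\<^sup>2 + (a g - c)\<^sup>2 = (\<Sum>i\<in>{0, g}. (a i - c)\<^sup>2)"
      using False by simp
    also have "\<dots> \<le> (\<Sum>i<5. (a i - c)\<^sup>2)" using assms by (intro sum_mono2) auto
    finally have "(a g - a 0)\<^sup>2 \<le> 2 * (\<Sum>i<5. (a i - c)\<^sup>2)" by simp
    moreover have "0 \<le> (\<Sum>i<5. (a i - c)\<^sup>2)" by (intro sum_nonneg) auto
    ultimately show ?thesis using var by linarith
  qed
qed

text \<open>Otherwise all displacements are strictly below 1/900 of the energy,
  \<open>energy_gap\<close> forces the energy to be 0, and a sum of squares would be
  negative.\<close>

lemma torus_displacement: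
  fixes f :: "nat \<Rightarrow> real"
  assumes "m > 0" and supp: "\<And>v. v \<notin> S \<Longrightarrow> f v = 0" "finite S" "real (card S) \<le> 7/10 * real (m * m)"
  shows "\<exists>g<5. (\<Sum>v<m * m. (f v)\<^sup>2) / 900 \<le> (\<Sum>v<m * m. (f (torus_map m g v) - f v)\<^sup>2)"
proof (rule ccontr)
  assume neg: "\<not> ?thesis"
  \<comment> \<open>The doubly periodic extension of \<open>f\<close> along the coding of
    vertices.\<close>
  define h where "h = (\<lambda>x y. f (nat (x mod int m) * m + nat (y mod int m)))"
  interpret periodic_function "int m" h
    by standard (use assms in \<open>auto simp: periodic_def h_def\<close>)
  have e0: "energy h = (\<Sum>v<m * m. (f v)\<^sup>2)"
    unfolding energy_def sum_torus[OF \<open>m > 0\<close>] by (intro sum.cong refl) (simp add: h_def)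
  have eg: "energy (\<lambda>x y. H x y - h x y) = (\<Sum>v<m * m. (f (torus_map m g v) - f v)\<^sup>2)"
    if H: "\<And>x y. x < m \<Longrightarrow> y < m \<Longrightarrow> H (int x) (int y) = f (torus_map m g (x * m + y))" for H g
    unfolding energy_def sum_torus[OF \<open>m > 0\<close>]
  proof (intro sum.cong refl)
    fix x y assume "x \<in> {0..<int m}" "y \<in> {0..<int m}"
    then have "0 \<le> x" "0 \<le> y" "nat x < m" "nat y < m" by auto
    then show "(H x y - h x y)\<^sup>2 = (f (torus_map m g (nat x * m + nat y)) - f (nat x * m + nat y))\<^sup>2"
      using H[of "nat x" "nat y"] by (simp add: h_def)
  qed
  have nm: "nat ((int x + int y) mod int m) = (x + y) mod m" "nat ((int x + 1) mod int m) = (x + 1) mod m" for x y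
    by (simp_all add: nat_mod_as_int add.commute)
  have "energy (\<lambda>x y. h (x + 1) y - h x y) = (\<Sum>v<m * m. (f (torus_map m 1 v) - f v)\<^sup>2)"
    by (rule eg) (simp add: h_def nm torus_map_def)
  moreover have "energy (\<lambda>x y. h x (y + 1) - h x y) = (\<Sum>v<m * m. (f (torus_map m 2 v) - f v)\<^sup>2)"
    by (rule eg) (simp add: h_def nm torus_map_def)
  moreover have "energy (\<lambda>x y. h (x + y) y - h x y) = (\<Sum>v<m * m. (f (torus_map m 3 v) - f v)\<^sup>2)"
    by (rule eg) (simp add: h_def nm torus_map_def)
  moreover have "energy (\<lambda>x y. h x (x + y) - h x y) = (\<Sum>v<m * m. (f (torus_map m 4 v) - f v)\<^sup>2)"
    by (rule eg) (simp add: h_def nm torus_map_def)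
  moreover have lt: "(\<Sum>v<m * m. (f (torus_map m g v) - f v)\<^sup>2) < energy h / 900" if "g < 5" for g
    using neg that e0 by auto
  moreover have "real (card {z \<in> {0..<int m} \<times> {0..<int m}. h (fst z) (snd z) \<noteq> 0}) \<le> 7/10 * (of_int (int m))\<^sup>2"
  proof -
    let ?code = "\<lambda>z. nat (fst z) * m + nat (snd z)"
    have "card {z \<in> {0..<int m} \<times> {0..<int m}. h (fst z) (snd z) \<noteq> 0} \<le> card S"
    proof (rule card_inj_on_le[of ?code])
      show "inj_on ?code {z \<in> {0..<int m} \<times> {0..<int m}. h (fst z) (snd z) \<noteq> 0}"
        by (rule inj_onI) (auto simp: prod_eq_iff dest!: torus_code_inject)
      show "?code ` {z \<in> {0..<int m} \<times> {0..<int m}. h (fst z) (snd z) \<noteq> 0} \<subseteq> S"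
      proof clarsimp
        fix a b assume "0 \<le> a" "a < int m" "0 \<le> b" "b < int m" "h a b \<noteq> 0"
        then have "f (nat a * m + nat b) \<noteq> 0" by (simp add: h_def)
        then show "nat a * m + nat b \<in> S" using supp(1) by blast
      qed
    qed (rule supp(2))
    then show ?thesis using supp(3) by (simp add: power2_eq_square)
  qed
  ultimately have "energy h = 0"
    by (intro energy_gap) (simp_all only: less_imp_le[OF lt] numeral_less_iff semiring_norm one_less_numeral_iff)
  moreover have "0 \<le> (\<Sum>v<m * m. (f (torus_map m 1 v) - f v)\<^sup>2)" by (intro sum_nonneg) simp
  ultimately show False using lt[of 1] by simp
qed

text \<open>Apply \<open>square_sum_le\<close> at each vertex to the five values of
  \<open>f\<close>. The maps permute the torus, so the five square sums agree and give 25 times the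
  energy, from which the displacement of one map is saved.\<close>

lemma torus_contraction:
  fixes f :: "nat \<Rightarrow> real"
  assumes "m > 0" and supp: "\<And>v. v \<notin> S \<Longrightarrow> f v = 0" "finite S" "real (card S) \<le> 7/10 * real (m * m)"
  shows "(\<Sum>v<m * m. (\<Sum>g<5. f (torus_map m g v))\<^sup>2) \<le> (25 - 1/900) * (\<Sum>v<m * m. (f v)\<^sup>2)"
proof -
  obtain g where g: "g < 5"
    "(\<Sum>v<m * m. (f v)\<^sup>2) / 900 \<le> (\<Sum>v<m * m. (f (torus_map m g v) - f v)\<^sup>2)"
    using torus_displacement[of m S f] assms by blast
  have inv: "(\<Sum>v<m * m. (f (torus_map m g v))\<^sup>2) = (\<Sum>v<m * m. (f v)\<^sup>2)" for g
    by (rule sum.reindex_bij_betw[OF bij_torus_map])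
  have "(\<Sum>v<m * m. (\<Sum>g<5. f (torus_map m g v))\<^sup>2) + (\<Sum>v<m * m. (f (torus_map m g v) - f v)\<^sup>2)
      \<le> (\<Sum>v<m * m. 5 * (\<Sum>g<5. (f (torus_map m g v))\<^sup>2))"
    unfolding sum.distrib[symmetric]
    using square_sum_le[OF g(1), of "\<lambda>g. f (torus_map m g v)" for v] by (intro sum_mono) simp
  also have "\<dots> = 5 * (\<Sum>g<5. \<Sum>v<m * m. (f (torus_map m g v))\<^sup>2)"
    unfolding sum_distrib_left[symmetric] by (subst sum.swap) simp
  also have "\<dots> = 25 * (\<Sum>v<m * m. (f v)\<^sup>2)" unfolding inv by simp
  finally show ?thesis using g(2) by (simp add: algebra_simps)
qed

section \<open>Walks that never leave a set\<close>

text \<open>This iterates, on the indicator of \<open>S\<close>, the operator that sums over the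
  five maps and then cuts off to \<open>S\<close>. By \<open>card_walks_staying\<close> it counts
  the words whose walk from \<open>v\<close> stays in \<open>S\<close>.\<close>

fun stay_count :: "nat \<Rightarrow> nat set \<Rightarrow> nat \<Rightarrow> nat \<Rightarrow> real" where
  "stay_count m S 0 v = of_bool (v \<in> S)"
| "stay_count m S (Suc k) v = of_bool (v \<in> S) * (\<Sum>g<5. stay_count m S k (torus_map m g v))"

text \<open>\<open>stay_count\<close> vanishes off \<open>S\<close>, so after the outer cut-off is
  dropped each step is one use of \<open>torus_contraction\<close>.\<close>

lemma sum_stay_count_square_le:
  assumes "m > 0" "S \<subseteq> {..<m * m}" "real (card S) \<le> 7/10 * real (m * m)"
  shows "(\<Sum>v<m * m. (stay_count m S k v)\<^sup>2) \<le> (25 - 1/900) ^ k * real (m * m)"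
proof (induction k)
  case 0
  have "(\<Sum>v<m * m. (stay_count m S 0 v)\<^sup>2) \<le> (\<Sum>v<m * m. 1)" by (intro sum_mono) auto
  then show ?case by simp
next
  case (Suc k)
  have z: "stay_count m S k v = 0" if "v \<notin> S" for v using that by (cases k) auto
  have "finite S" using assms(2) finite_subset by blast
  have "(\<Sum>v<m * m. (stay_count m S (Suc k) v)\<^sup>2)
      \<le> (\<Sum>v<m * m. (\<Sum>g<5. stay_count m S k (torus_map m g v))\<^sup>2)"
    by (intro sum_mono) auto
  also have "\<dots> \<le> (25 - 1/900) * (\<Sum>v<m * m. (stay_count m S k v)\<^sup>2)"
    by (rule torus_contraction[OF assms(1) z \<open>finite S\<close> assms(3)])
  also have "\<dots> \<le> (25 - 1/900) * ((25 - 1/900) ^ k * real (m * m))"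
    using Suc by (intro mult_left_mono) auto
  finally show ?case by simp
qed

text \<open>Cauchy-Schwarz passes from the square sum back to the count. The rate comes from 25 -
  1/900 = 25 (1 - 1/22500) <= 25 exp(-1/22500), and the square root halves the exponent.\<close>

lemma sum_stay_count_le:
  assumes "m > 0" "S \<subseteq> {..<m * m}" "real (card S) \<le> 7/10 * real (m * m)"
  shows "(\<Sum>v<m * m. stay_count m S k v) \<le> real (m * m) * 5 ^ k * exp (- real k / 45000)"
proof (rule power2_le_imp_le)
  have "(\<Sum>v<m * m. stay_count m S k v * 1)\<^sup>2 \<le> (\<Sum>v<m * m. (stay_count m S k v)\<^sup>2) * (\<Sum>v<m * m. 1\<^sup>2)"
    by (rule Cauchy_Schwarz_ineq_sum)
  also have "\<dots> \<le> ((25 - 1/900) ^ k * real (m * m)) * real (m * m)"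
    using sum_stay_count_square_le[OF assms, of k] by (intro mult_mono) auto
  also have "\<dots> \<le> ((25 * exp (- 1 / 22500)) ^ k * real (m * m)) * real (m * m)"
  proof -
    have "(25 - 1/900 :: real) \<le> 25 * exp (- 1 / 22500)"
      using exp_ge_add_one_self[of "- 1 / 22500"] by simp
    then show ?thesis by (intro mult_right_mono power_mono) auto
  qed
  also have "\<dots> = (real (m * m) * 5 ^ k * exp (- real k / 45000))\<^sup>2"
  proof -
    have "exp (- 1 / 22500 :: real) ^ k = exp (- real k / 45000) ^ 2"
      by (simp add: exp_of_nat_mult[symmetric])
    moreover have "(25::real) ^ k = (5 ^ k)\<^sup>2" by (simp add: power2_eq_square power_mult_distrib[symmetric])
    ultimately show ?thesis by (simp add: power_mult_distrib power2_eq_square)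
  qed
  finally show "(\<Sum>v<m * m. stay_count m S k v)\<^sup>2 \<le> (real (m * m) * 5 ^ k * exp (- real k / 45000))\<^sup>2"
    by simp
qed simp

fun walk :: "nat \<Rightarrow> nat \<Rightarrow> nat list \<Rightarrow> nat list" where
  "walk m v [] = [v]"
| "walk m v (g # gs) = v # walk m (torus_map m g v) gs"

definition words :: "nat \<Rightarrow> nat list set" where
  "words k = {gs. set gs \<subseteq> {..<5} \<and> length gs = k}"

lemma finite_words: "finite (words k)"
  unfolding words_def by (rule finite_lists_length_eq) simp

lemma card_words: "card (words k) = 5 ^ k"
  unfolding words_def by (subst card_lists_length_eq) simp_all

lemma words_Suc: "words (Suc k) = (\<lambda>(g, gs). g # gs) ` ({..<5} \<times> words k)"
  unfolding words_def by (force simp: length_Suc_conv image_iff)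

lemma card_walks_staying:
  "real (card {gs \<in> words k. set (walk m v gs) \<subseteq> S}) = stay_count m S k v"
proof (induction k arbitrary: v)
  case 0
  have "{gs \<in> words 0. set (walk m v gs) \<subseteq> S} = (if v \<in> S then {[]} else {})"
    by (auto simp: words_def)
  then show ?case by simp
next
  case (Suc k)
  have fin: "finite {gs \<in> words k. set (walk m w gs) \<subseteq> S}" for w using finite_words by simp
  show ?case
  proof (cases "v \<in> S")
    case True
    then have "{gs \<in> words (Suc k). set (walk m v gs) \<subseteq> S}
      = (\<lambda>(g, gs). g # gs) ` (SIGMA g:{..<5}. {gs \<in> words k. set (walk m (torus_map m g v) gs) \<subseteq> S})"
      unfolding words_Suc by auto
    also have "card \<dots> = card (SIGMA g:{..<5::nat}. {gs \<in> words k. set (walk m (torus_map m g v) gs) \<subseteq> S})"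
      by (rule card_image) (auto simp: inj_on_def)
    also have "\<dots> = (\<Sum>g<5. card {gs \<in> words k. set (walk m (torus_map m g v) gs) \<subseteq> S})"
      using fin by (intro card_SigmaI) auto
    finally show ?thesis using True Suc by simp
  next
    case False
    then have none: "{gs \<in> words (Suc k). set (walk m v gs) \<subseteq> S} = {}" unfolding words_Suc by auto
    show ?thesis unfolding none using False by simp
  qed
qed

lemma card_staying_seeds_le:
  assumes "m > 0" "S \<subseteq> {..<m * m}" "real (card S) \<le> 7/10 * real (m * m)"
  shows "real (card {(v, gs) \<in> {..<m * m} \<times> words k. set (walk m v gs) \<subseteq> S})
    \<le> real (m * m) * 5 ^ k * exp (- real k / 45000)"
proof -
  have "{(v, gs) \<in> {..<m * m} \<times> words k. set (walk m v gs) \<subseteq> S}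
      = (SIGMA v:{..<m * m}. {gs \<in> words k. set (walk m v gs) \<subseteq> S})" by auto
  then have "real (card {(v, gs) \<in> {..<m * m} \<times> words k. set (walk m v gs) \<subseteq> S})
      = (\<Sum>v<m * m. real (card {gs \<in> words k. set (walk m v gs) \<subseteq> S}))"
    using finite_words by (subst \<open>_ = _\<close>, subst card_SigmaI) auto
  then show ?thesis unfolding card_walks_staying using sum_stay_count_le[OF assms] by simp
qed

section \<open>Capped graph distances and tours\<close>

text \<open>Admitting \<open>L\<close> as a candidate inside \<open>LEAST\<close> caps the distance
  and also gives points joined by no path, such as the padding points, a distance.\<close>

definition capped_dist :: "('a \<times> 'a) set \<Rightarrow> nat \<Rightarrow> 'a \<Rightarrow> 'a \<Rightarrow> nat" where
  "capped_dist E L u v = (LEAST r. r = L \<or> (u, v) \<in> E ^^ r)"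

lemma capped_dist_le: "capped_dist E L u v \<le> L"
  unfolding capped_dist_def by (rule Least_le) simp

lemma capped_dist_le_relpow: "(u, v) \<in> E ^^ r \<Longrightarrow> capped_dist E L u v \<le> r"
  unfolding capped_dist_def by (rule Least_le) simp

lemma capped_dist_cases: "capped_dist E L u v = L \<or> (u, v) \<in> E ^^ capped_dist E L u v"
  unfolding capped_dist_def by (rule LeastI[of _ L]) simp

lemma relpow_sym: "sym E \<Longrightarrow> (u, v) \<in> E ^^ r \<Longrightarrow> (v, u) \<in> E ^^ r"
proof (induction r arbitrary: u v)
  case (Suc r)
  then show ?case by (metis relpow_Suc_E relpow_Suc_I2 symD)
qed simp

text \<open>If one of the two terms is already \<open>L\<close>, the cap suffices; otherwise both
  are realised by paths, which concatenate.\<close>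

lemma capped_dist_triangle: "capped_dist E L u w \<le> capped_dist E L u v + capped_dist E L v w"
proof (cases "capped_dist E L u v = L \<or> capped_dist E L v w = L")
  case True
  then show ?thesis using capped_dist_le[of E L u w] by auto
next
  case False
  then have "(u, v) \<in> E ^^ capped_dist E L u v" "(v, w) \<in> E ^^ capped_dist E L v w"
    using capped_dist_cases by metis+
  then show ?thesis by (meson capped_dist_le_relpow relpow_trans)
qed

lemma capped_dist_sym: "sym E \<Longrightarrow> capped_dist E L u v = capped_dist E L v u"
  unfolding capped_dist_def by (metis relpow_sym)

lemma metric_on_capped_dist:
  assumes "sym E" "L > 0"
  shows "metric_on V (\<lambda>u v. real (capped_dist E L u v))"
  unfolding metric_on_def
proof (intro conjI ballI impI)
  show "real (capped_dist E L x x) = 0" for x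
    using capped_dist_le_relpow[of x x 0 E L] by simp
  show "0 < real (capped_dist E L x y)" if "x \<noteq> y" for x y
    using capped_dist_cases[of E L x y] that assms(2) by (cases "capped_dist E L x y = 0") auto
  show "real (capped_dist E L x y) = real (capped_dist E L y x)" for x y
    using capped_dist_sym[OF assms(1)] by simp
  show "real (capped_dist E L x z) \<le> real (capped_dist E L x y) + real (capped_dist E L y z)" for x y z
    using capped_dist_triangle[of E L x z y] by linarith
qed

section \<open>Growth of balls and the torus graph\<close>

lemma card_relpow_le:
  fixes E :: "('a \<times> 'a) set"
  assumes "\<And>v. finite (E `` {v})" "\<And>v. card (E `` {v}) \<le> d"
  shows "finite ((E ^^ r) `` {v}) \<and> card ((E ^^ r) `` {v}) \<le> d ^ r"
proof (induction r)
  case (Suc r)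
  have eq: "(E ^^ Suc r) `` {v} = (\<Union>w\<in>(E ^^ r) `` {v}. E `` {w})" by auto
  have "card ((E ^^ Suc r) `` {v}) \<le> (\<Sum>w\<in>(E ^^ r) `` {v}. card (E `` {w}))"
    unfolding eq using Suc by (intro card_UN_le) simp
  also have "\<dots> \<le> (\<Sum>w\<in>(E ^^ r) `` {v}. d)" using assms(2) by (intro sum_mono)
  also have "\<dots> \<le> d ^ Suc r" using Suc by simp
  finally show ?case unfolding eq using Suc assms(1) by (metis eq finite_UN_I)
qed simp

lemma geometric_sum_le_power: "d \<ge> 2 \<Longrightarrow> (\<Sum>r<R. d ^ r) \<le> (d ^ R :: nat)"
proof (induction R)
  case (Suc R)
  then have "(\<Sum>r<Suc R. d ^ r) \<le> 2 * d ^ R" by simp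
  also have "\<dots> \<le> d * d ^ R" using Suc.prems by (intro mult_right_mono) auto
  finally show ?case by simp
qed simp

text \<open>With degree at most \<open>d\<close>, the spheres of radius below \<open>R\<close>
  around a point have together at most the geometric sum of the powers of \<open>d\<close>, hence at
  most \<open>d ^ R\<close> points.\<close>

lemma card_near_pairs_le:
  fixes E :: "('a \<times> 'a) set"
  assumes "\<And>v. finite (E `` {v})" "\<And>v. card (E `` {v}) \<le> d" "d \<ge> 2" "finite V"
  shows "card {(u, v) \<in> V \<times> V. \<exists>r<R. (u, v) \<in> E ^^ r} \<le> card V * d ^ R"
proof -
  have "{(u, v) \<in> V \<times> V. \<exists>r<R. (u, v) \<in> E ^^ r} \<subseteq> (SIGMA u:V. \<Union>r<R. (E ^^ r) `` {u})" by auto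
  then have "card {(u, v) \<in> V \<times> V. \<exists>r<R. (u, v) \<in> E ^^ r} \<le> card (SIGMA u:V. \<Union>r<R. (E ^^ r) `` {u})"
    using card_relpow_le[OF assms(1,2)] assms(4) by (intro card_mono finite_SigmaI) auto
  also have "\<dots> = (\<Sum>u\<in>V. card (\<Union>r<R. (E ^^ r) `` {u}))"
    using card_relpow_le[OF assms(1,2)] assms(4) by (intro card_SigmaI) auto
  also have "\<dots> \<le> (\<Sum>u\<in>V. \<Sum>r<R. card ((E ^^ r) `` {u}))" by (intro sum_mono card_UN_le) simp
  also have "\<dots> \<le> (\<Sum>u\<in>V. \<Sum>r<R. d ^ r)"
    using card_relpow_le[OF assms(1,2)] by (intro sum_mono) auto
  also have "\<dots> \<le> card V * d ^ R" using geometric_sum_le_power[OF assms(3), of R] by simp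
  finally show ?thesis .
qed

text \<open>The converse is added to make the distance symmetric; the bound on \<open>v\<close>
  leaves the padding points isolated.\<close>

definition torus_edges :: "nat \<Rightarrow> (nat \<times> nat) set" where
  "torus_edges m = (let A = {(v, torus_map m g v) | v g. v < m * m \<and> g < 5} in A \<union> A\<inverse>)"

lemma sym_torus_edges: "sym (torus_edges m)"
  unfolding torus_edges_def Let_def by (rule sym_Un_converse)

lemma torus_edgesI: "v < m * m \<Longrightarrow> g < 5 \<Longrightarrow> (v, torus_map m g v) \<in> torus_edges m"
  unfolding torus_edges_def Let_def by blast

text \<open>Each of the five maps contributes one image and, being injective on the torus, at most
  one preimage.\<close>

lemma card_torus_edges: "finite (torus_edges m `` {v}) \<and> card (torus_edges m `` {v}) \<le> 10"
proof -
  let ?inv = "\<lambda>g. the_inv_into {..<m * m} (torus_map m g) v"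
  have "torus_edges m `` {v} \<subseteq> (\<lambda>g. torus_map m g v) ` {..<5} \<union> ?inv ` {..<5}"
  proof
    fix w assume "w \<in> torus_edges m `` {v}"
    then consider g where "g < 5" "w = torus_map m g v" | g where "g < 5" "w < m * m" "v = torus_map m g w"
      unfolding torus_edges_def Let_def by blast
    then show "w \<in> (\<lambda>g. torus_map m g v) ` {..<5} \<union> ?inv ` {..<5}"
    proof cases
      case 2
      then have "w = ?inv g"
        using bij_torus_map[of m g] by (auto simp: bij_betw_def the_inv_into_f_f)
      with 2 show ?thesis by blast
    qed blast
  qed
  moreover have fin: "finite ((\<lambda>g. torus_map m g v) ` {..<5} \<union> ?inv ` {..<5})" by simp
  moreover have "card ((\<lambda>g. torus_map m g v) ` {..<5} \<union> ?inv ` {..<5}) \<le> 10"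
  proof -
    have "card ((\<lambda>g. torus_map m g v) ` {..<5}) \<le> 5" "card (?inv ` {..<5}) \<le> 5"
      using card_image_le[of "{..<5::nat}"] by (simp_all add: order_trans[OF card_image_le])
    then show ?thesis using card_Un_le[of "(\<lambda>g. torus_map m g v) ` {..<5}" "?inv ` {..<5}"] by linarith
  qed
  ultimately show ?thesis by (meson card_mono finite_subset order_trans)
qed

lemma walk_nonempty [simp]: "walk m v gs \<noteq> []"
  by (cases gs) auto

lemma hd_walk [simp]: "hd (walk m v gs) = v"
  by (cases gs) auto

lemma walk_less: "v < m * m \<Longrightarrow> set (walk m v gs) \<subseteq> {..<m * m}"
proof (induction gs arbitrary: v)
  case (Cons g gs)
  then show ?case using Cons.IH[OF torus_map_less, of v g] by simp
qed simp

lemma length_walk: "length (walk m v gs) = Suc (length gs)"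
  by (induction gs arbitrary: v) auto

lemma walk_relpow:
  assumes "v < m * m" "set gs \<subseteq> {..<5}" "w \<in> set (walk m v gs)"
  shows "\<exists>r \<le> length gs. (v, w) \<in> torus_edges m ^^ r"
  using assms
proof (induction gs arbitrary: v)
  case (Cons g gs)
  show ?case
  proof (cases "w = v")
    case True
    then show ?thesis by (intro exI[of _ 0]) auto
  next
    case False
    with Cons.prems have "w \<in> set (walk m (torus_map m g v) gs)" by simp
    then obtain r where "r \<le> length gs" "(torus_map m g v, w) \<in> torus_edges m ^^ r"
      using Cons.IH[of "torus_map m g v"] Cons.prems torus_map_less by auto
    moreover have "(v, torus_map m g v) \<in> torus_edges m" using Cons.prems by (intro torus_edgesI) auto
    ultimately show ?thesis by (intro exI[of _ "Suc r"]) (auto intro: relpow_Suc_I2 simp del: relpow.simps)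
  qed
qed auto

text \<open>If \<open>u\<close> and \<open>v\<close> were closer than \<open>k\<close>, following
  one walk from \<open>x\<close> to \<open>u\<close>, then going to \<open>v\<close>, then back
  along the other walk to \<open>y\<close>, would take fewer than 3 k steps.\<close>

lemma walks_far_apart:
  assumes "\<And>r. r < 3 * k \<Longrightarrow> (x, y) \<notin> torus_edges m ^^ r"
    and "x < m * m" "y < m * m" "gs \<in> words k" "hs \<in> words k"
    and "u \<in> set (walk m x gs)" "v \<in> set (walk m y hs)"
  shows "capped_dist (torus_edges m) k u v = k"
proof (rule ccontr)
  let ?E = "torus_edges m"
  assume neq: "capped_dist ?E k u v \<noteq> k"
  define d where "d = capped_dist ?E k u v"
  have d: "d < k" "(u, v) \<in> ?E ^^ d"
    using neq capped_dist_le[of ?E k u v] capped_dist_cases[of ?E k u v] by (auto simp: d_def)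
  obtain a where a: "a \<le> k" "(x, u) \<in> ?E ^^ a"
    using walk_relpow[of x m gs u] assms by (auto simp: words_def)
  obtain b where b: "b \<le> k" "(y, v) \<in> ?E ^^ b"
    using walk_relpow[of y m hs v] assms by (auto simp: words_def)
  have "(x, y) \<in> ?E ^^ (a + d + b)"
    by (intro relpow_trans[OF relpow_trans[OF a(2) d(2)]] relpow_sym[OF sym_torus_edges b(2)])
  then show False using assms(1)[of "a + d + b"] a b d by auto
qed

section \<open>Costs of paths and tours\<close>

lemma path_cost_nonneg: "(\<And>u v. c u v \<ge> 0) \<Longrightarrow> path_cost c xs \<ge> 0"
  by (induction c xs rule: path_cost.induct) (auto intro: add_nonneg_nonneg)

lemma path_cost_Cons: "xs \<noteq> [] \<Longrightarrow> path_cost c (x # xs) = c x (hd xs) + path_cost c xs"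
  by (cases xs) auto

lemma path_cost_append:
  "xs \<noteq> [] \<Longrightarrow> ys \<noteq> [] \<Longrightarrow> path_cost c (xs @ ys) = path_cost c xs + c (last xs) (hd ys) + path_cost c ys"
  by (induction xs rule: list_nonempty_induct) (auto simp: path_cost_Cons)

text \<open>Dropping an entry is a shortcut, by the triangle inequality.\<close>

lemma path_cost_remdups_le:
  assumes "metric_on UNIV c"
  shows "path_cost c (a # remdups xs @ [b]) \<le> path_cost c (a # xs @ [b])"
proof (induction xs arbitrary: a)
  case (Cons x xs)
  have "c a (hd (xs @ [b])) \<le> c a x + c x (hd (xs @ [b]))"
    using assms by (simp add: metric_on_def)
  then have "path_cost c (a # xs @ [b]) \<le> path_cost c (a # (x # xs) @ [b])"
    by (simp add: path_cost_Cons)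
  with Cons[of a] have "path_cost c (a # remdups xs @ [b]) \<le> path_cost c (a # (x # xs) @ [b])" by simp
  with Cons[of x] show ?case by simp
qed simp

lemma finite_tour_costs: "finite X \<Longrightarrow> finite {tour_cost c r xs | xs. distinct xs \<and> set xs = X}"
proof -
  assume "finite X"
  then have "finite {xs. set xs \<subseteq> X \<and> length xs \<le> card X}" by (rule finite_lists_length_le)
  moreover have "{xs. distinct xs \<and> set xs = X} \<subseteq> {xs. set xs \<subseteq> X \<and> length xs \<le> card X}"
    by (auto simp: distinct_card)
  ultimately have "finite {xs. distinct xs \<and> set xs = X}" by (rule finite_subset[rotated])
  then have "finite (tour_cost c r ` {xs. distinct xs \<and> set xs = X})" by simp
  then show ?thesis by (simp add: image_Collect)
qed

text \<open>\<open>opt_tsp\<close> ranges over lists without repetition, whereas walks may revisit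
  vertices; shortcutting makes any list an admissible upper bound.\<close>

lemma opt_tsp_le_tour_cost:
  assumes "metric_on UNIV c" shows "opt_tsp c r (set xs) \<le> tour_cost c r xs"
proof -
  have "opt_tsp c r (set xs) \<le> tour_cost c r (remdups xs)"
    unfolding opt_tsp_def by (rule Min_le[OF finite_tour_costs]) (auto intro!: exI[of _ "remdups xs"])
  also have "\<dots> \<le> tour_cost c r xs"
    unfolding tour_cost_def by (rule path_cost_remdups_le[OF assms])
  finally show ?thesis .
qed

lemma opt_tsp_nonneg:
  assumes "\<And>u v. c u v \<ge> 0" "finite X" shows "opt_tsp c r X \<ge> 0"
proof -
  let ?C = "{tour_cost c r xs | xs. distinct xs \<and> set xs = X}"
  obtain xs where "set xs = X" "distinct xs" using finite_distinct_list[OF assms(2)] by blast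
  then have "?C \<noteq> {}" by blast
  then have "Min ?C \<in> ?C" by (rule Min_in[OF finite_tour_costs[OF assms(2)]])
  then show ?thesis unfolding opt_tsp_def tour_cost_def using path_cost_nonneg[of c] assms(1) by auto
qed

lemma path_cost_walk_le:
  assumes "v < m * m" "set gs \<subseteq> {..<5}"
  shows "path_cost (\<lambda>u v. real (capped_dist (torus_edges m) L u v)) (walk m v gs) \<le> length gs"
  using assms
proof (induction gs arbitrary: v)
  case (Cons g gs)
  have "(v, torus_map m g v) \<in> torus_edges m ^^ 1" using Cons.prems torus_edgesI by simp
  then have "capped_dist (torus_edges m) L v (torus_map m g v) \<le> 1" by (rule capped_dist_le_relpow)
  moreover have "path_cost (\<lambda>u v. real (capped_dist (torus_edges m) L u v)) (walk m (torus_map m g v) gs) \<le> length gs"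
    using Cons.prems by (intro Cons.IH) (auto simp: torus_map_less)
  ultimately show ?case by (simp add: path_cost_Cons)
qed simp

text \<open>Five pieces of cost at most \<open>k\<close> each: from the root to the first walk, the
  first walk in steps of cost at most 1, the jump, the second walk, and the return.\<close>

lemma opt_tsp_walks_le:
  assumes "x < m * m" "y < m * m" "gs \<in> words k" "hs \<in> words k" "k > 0"
  shows "opt_tsp (\<lambda>u v. real (capped_dist (torus_edges m) k u v)) r (set (walk m x gs) \<union> set (walk m y hs))
    \<le> 5 * real k"
proof -
  let ?c = "\<lambda>u v. real (capped_dist (torus_edges m) k u v)"
  have c: "?c u v \<le> real k" for u v using capped_dist_le by simp
  have "opt_tsp ?c r (set (walk m x gs @ walk m y hs)) \<le> tour_cost ?c r (walk m x gs @ walk m y hs)"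
    by (rule opt_tsp_le_tour_cost[OF metric_on_capped_dist[OF sym_torus_edges \<open>k > 0\<close>]])
  also have "\<dots> = ?c r x + (path_cost ?c (walk m x gs) + ?c (last (walk m x gs)) y
      + (path_cost ?c (walk m y hs) + ?c (last (walk m y hs)) r))"
    by (simp add: tour_cost_def path_cost_Cons path_cost_append)
  also have "\<dots> \<le> real k + (real k + real k + (real k + real k))"
    using path_cost_walk_le[of x m gs k] path_cost_walk_le[of y m hs k] assms
    by (intro add_mono c) (auto simp: words_def)
  finally show ?thesis by simp
qed

text \<open>The list runs through the blocks in order, so a block containing both colours is
  traversed contiguously and contains a step that changes colour. In the induction, prepending
  \<open>x\<close> creates at most one new shared block, and only when the step from
  \<open>x\<close> to \<open>y\<close> is such a change.\<close>

lemma path_cost_ge_shared: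
  fixes bl :: "'a \<Rightarrow> nat"
  assumes "\<And>u v. c u v \<ge> 0" "\<And>u v. u \<in> R \<Longrightarrow> v \<in> B \<Longrightarrow> c u v \<ge> L \<and> c v u \<ge> L"
    and "sorted (map bl xs)" "set xs \<subseteq> R \<union> B" "R \<inter> B = {}" "L \<ge> 0"
  shows "L * real (card (bl ` (R \<inter> set xs) \<inter> bl ` (B \<inter> set xs))) \<le> path_cost c xs"
  using assms(3,4)
proof (induction xs rule: induct_list012)
  case (3 x y zs)
  define shared where "shared = (\<lambda>xs. bl ` (R \<inter> set xs) \<inter> bl ` (B \<inter> set xs))"
  have IH: "L * real (card (shared (y # zs))) \<le> path_cost c (y # zs)"
    using 3 unfolding shared_def by simp
  show ?case
  proof (cases "shared (x # y # zs) \<subseteq> shared (y # zs)")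
    case True
    then have "shared (x # y # zs) = shared (y # zs)" by (auto simp: shared_def)
    then show ?thesis using IH assms(1)[of x y] unfolding shared_def by simp
  next
    case False
    then obtain i where i: "i \<in> shared (x # y # zs)" "i \<notin> shared (y # zs)" by blast
    then have "i = bl x" by (auto simp: shared_def)
    have le: "bl x \<le> bl y" "\<And>w. w \<in> set (y # zs) \<Longrightarrow> bl y \<le> bl w" using "3.prems" by auto
    have sharedI: "j \<in> shared xs"
      if "a \<in> R" "a \<in> set xs" "b \<in> B" "b \<in> set xs" "bl a = j" "bl b = j" for a b j xs
      unfolding shared_def using that by (intro IntI image_eqI[of _ bl a] image_eqI[of _ bl b]) auto
    have "x \<in> R \<and> y \<in> B \<or> x \<in> B \<and> y \<in> R"
    proof (cases "x \<in> R")
      case True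
      then have "x \<notin> B" using assms(5) by blast
      then obtain w where w: "w \<in> B" "w \<in> set (y # zs)" "bl w = i" using i(1) by (auto simp: shared_def)
      \<comment> \<open>Sortedness squeezes \<open>bl y\<close> between \<open>bl x\<close> and
        \<open>bl w\<close>, both equal to \<open>i\<close>. If \<open>y\<close> had the colour of
        \<open>x\<close>, then \<open>y\<close> and \<open>w\<close> would already make
        \<open>i\<close> shared in the tail.\<close>
      then have "bl y = i" using le \<open>i = bl x\<close> by (metis le_antisym)
      then have "y \<notin> R" using i(2) w sharedI[of y "y # zs" w i] by auto
      then show ?thesis using True "3.prems" by auto
    next
      case False
      then have "x \<in> B" using "3.prems" by auto
      obtain w where w: "w \<in> R" "w \<in> set (y # zs)" "bl w = i" using i(1) False by (auto simp: shared_def)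
      then have "bl y = i" using le \<open>i = bl x\<close> by (metis le_antisym)
      then have "y \<notin> B" using i(2) w sharedI[of w "y # zs" y i] by auto
      then show ?thesis using \<open>x \<in> B\<close> "3.prems" by auto
    qed
    then have "L \<le> c x y" using assms(2) by blast
    have fin: "finite (shared xs)" for xs unfolding shared_def by simp
    have "shared (x # y # zs) \<subseteq> insert (bl x) (shared (y # zs))" by (auto simp: shared_def)
    then have "card (shared (x # y # zs)) \<le> card (insert (bl x) (shared (y # zs)))"
      using fin by (intro card_mono) auto
    also have "\<dots> \<le> Suc (card (shared (y # zs)))" by (rule card_insert_le_m1[OF zero_less_Suc]) simp
    finally have "L * real (card (shared (x # y # zs))) \<le> L * (real (card (shared (y # zs))) + 1)"
      using assms(6) by (intro mult_left_mono) auto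
    then show ?thesis using IH \<open>L \<le> c x y\<close> unfolding shared_def by (simp add: algebra_simps)
  qed
next
  case (2 x)
  have "R \<inter> set [x] = {} \<or> B \<inter> set [x] = {}" using assms(5) by auto
  then have none: "bl ` (R \<inter> set [x]) \<inter> bl ` (B \<inter> set [x]) = {}"
    by (elim disjE) (simp_all only: image_empty Int_empty_left Int_empty_right)
  show ?case unfolding none by simp
qed simp

section \<open>Confinement of walks to blocks of a tour\<close>

text \<open>The position of \<open>v\<close> in the tour, divided by the block size; meaningful only for \<open>v\<close> on the tour.\<close>

definition block :: "nat \<Rightarrow> 'a list \<Rightarrow> 'a \<Rightarrow> nat" where
  "block s \<sigma> v = inv_into {..<length \<sigma>} ((!) \<sigma>) v div s"

lemma block_nth: "distinct \<sigma> \<Longrightarrow> i < length \<sigma> \<Longrightarrow> block s \<sigma> (\<sigma> ! i) = i div s"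
  unfolding block_def by (subst inv_into_f_f) (auto intro: inj_on_nth)

lemma sorted_blocks: "distinct \<sigma> \<Longrightarrow> sorted (map (block s \<sigma>) \<sigma>)"
  by (auto simp: sorted_iff_nth_mono block_nth div_le_mono)

lemma card_blocks_le:
  assumes "distinct \<sigma>" "s > 0" "finite I"
  shows "card {v \<in> set \<sigma>. block s \<sigma> v \<in> I} \<le> card I * s"
proof -
  have "{v \<in> set \<sigma>. block s \<sigma> v \<in> I} \<subseteq> (\<lambda>(b, i). \<sigma> ! (b * s + i)) ` (I \<times> {..<s})"
  proof
    fix v assume "v \<in> {v \<in> set \<sigma>. block s \<sigma> v \<in> I}"
    then have v: "v \<in> set \<sigma>" "block s \<sigma> v \<in> I" by auto
    from v(1) obtain i where "i < length \<sigma>" "v = \<sigma> ! i" by (metis in_set_conv_nth)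
    with v(2) have "i < length \<sigma>" "v = \<sigma> ! i" "i div s \<in> I" using block_nth[OF assms(1)] by auto
    then show "v \<in> (\<lambda>(b, i). \<sigma> ! (b * s + i)) ` (I \<times> {..<s})"
      using assms(2) by (intro image_eqI[of _ _ "(i div s, i mod s)"]) auto
  qed
  then have "card {v \<in> set \<sigma>. block s \<sigma> v \<in> I} \<le> card ((\<lambda>(b, i). \<sigma> ! (b * s + i)) ` (I \<times> {..<s}))"
    using assms(3) by (intro card_mono) auto
  also have "\<dots> \<le> card (I \<times> {..<s})" using assms(3) by (intro card_image_le) auto
  finally show ?thesis by (simp add: card_cartesian_product)
qed

lemma tour_cost_ge_path_cost:
  assumes "\<And>u v. c u v \<ge> 0" shows "path_cost c xs \<le> tour_cost c r xs"
proof (cases "xs = []")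
  case True
  then show ?thesis using assms by (simp add: tour_cost_def)
next
  case False
  then have "tour_cost c r xs = c r (hd xs) + (path_cost c xs + c (last xs) r)"
    by (simp add: tour_cost_def path_cost_Cons path_cost_append)
  then show ?thesis using assms[of r "hd xs"] assms[of "last xs" r] by simp
qed

text \<open>Restricting a tour to the visited set keeps its order, so block numbers still increase
  along it and each shared block costs a step of length \<open>k\<close>.\<close>

lemma tour_cost_ge_shared:
  assumes "sym E" "k > 0" "distinct \<sigma>" "R \<union> B \<subseteq> set \<sigma>"
    and far: "\<And>u v. u \<in> R \<Longrightarrow> v \<in> B \<Longrightarrow> capped_dist E k u v = k"
  shows "real k * real (card (block s \<sigma> ` R \<inter> block s \<sigma> ` B))
    \<le> tour_cost (\<lambda>u v. real (capped_dist E k u v)) r (restrict_tour \<sigma> (R \<union> B))"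
proof -
  let ?c = "\<lambda>u v. real (capped_dist E k u v)"
  let ?xs = "restrict_tour \<sigma> (R \<union> B)"
  have set: "set ?xs = R \<union> B" using assms(4) by (auto simp: restrict_tour_def)
  \<comment> \<open>A common vertex would be at distance 0 from itself, not
    \<open>k\<close>.\<close>
  have disj: "R \<inter> B = {}"
  proof (rule ccontr)
    assume "R \<inter> B \<noteq> {}"
    then obtain v where "capped_dist E k v v = k" using far by blast
    moreover have "capped_dist E k v v \<le> 0" by (rule capped_dist_le_relpow) simp
    ultimately show False using assms(2) by simp
  qed
  have "real k * real (card (block s \<sigma> ` (R \<inter> set ?xs) \<inter> block s \<sigma> ` (B \<inter> set ?xs))) \<le> path_cost ?c ?xs"
  proof (rule path_cost_ge_shared[OF _ _ _ _ disj])
    show "sorted (map (block s \<sigma>) ?xs)"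
      unfolding restrict_tour_def by (intro sorted_filter sorted_blocks assms)
    show "real k \<le> ?c u v \<and> real k \<le> ?c v u" if "u \<in> R" "v \<in> B" for u v
      using far[OF that] capped_dist_sym[OF assms(1), of k u v] by simp
  qed (use set in auto)
  also have "\<dots> \<le> tour_cost ?c r ?xs" by (rule tour_cost_ge_path_cost) simp
  also have "R \<inter> set ?xs = R" using set by auto
  also have "B \<inter> set ?xs = B" using set by auto
  finally show ?thesis .
qed

section \<open>Counting pairs of walks\<close>

text \<open>A seed is a starting vertex with a word of maps. Probabilities for a uniform random walk
  become proportions of seeds.\<close>

definition seeds :: "nat \<Rightarrow> nat \<Rightarrow> (nat \<times> nat list) set" where
  "seeds m k = {..<m * m} \<times> words k"

definition visited :: "nat \<Rightarrow> nat \<times> nat list \<Rightarrow> nat set" where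
  "visited m p = set (walk m (fst p) (snd p))"

lemma card_seeds: "card (seeds m k) = m * m * 5 ^ k"
  by (simp add: seeds_def card_cartesian_product card_words)

lemma finite_seeds: "finite (seeds m k)"
  by (simp add: seeds_def finite_words)

lemma visited_subset: "p \<in> seeds m k \<Longrightarrow> visited m p \<subseteq> {..<m * m}"
  unfolding visited_def by (rule walk_less) (auto simp: seeds_def)

lemma finite_visited: "finite (visited m p)"
  by (simp add: visited_def)

lemma card_visited_le: "p \<in> seeds m k \<Longrightarrow> card (visited m p) \<le> k + 1"
  using card_length[of "walk m (fst p) (snd p)"]
  by (auto simp: visited_def seeds_def words_def length_walk)

text \<open>Only the starting vertices matter; the two words contribute the factor 25^k, and 10 is
  the degree bound.\<close>

lemma card_near_seeds_le:
  "card {(p, q) \<in> seeds m k \<times> seeds m k. \<exists>r<R. (fst p, fst q) \<in> torus_edges m ^^ r}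
    \<le> m * m * 10 ^ R * 25 ^ k"
proof -
  let ?near = "{(u, v) \<in> {..<m * m} \<times> {..<m * m}. \<exists>r<R. (u, v) \<in> torus_edges m ^^ r}"
  have fin: "finite ?near" by (rule finite_subset[of _ "{..<m * m} \<times> {..<m * m}"]) auto
  have "{(p, q) \<in> seeds m k \<times> seeds m k. \<exists>r<R. (fst p, fst q) \<in> torus_edges m ^^ r}
      \<subseteq> (\<lambda>((u, v), (gs, hs)). ((u, gs), (v, hs))) ` (?near \<times> (words k \<times> words k))"
  proof clarify
    fix u gs v hs r
    assume "(u, gs) \<in> seeds m k" "(v, hs) \<in> seeds m k" "r < R"
      "(fst (u, gs), fst (v, hs)) \<in> torus_edges m ^^ r"
    then have "((u, v), (gs, hs)) \<in> ?near \<times> (words k \<times> words k)"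
      unfolding seeds_def by auto
    then show "((u, gs), (v, hs)) \<in> (\<lambda>((u, v), (gs, hs)). ((u, gs), (v, hs))) ` (?near \<times> (words k \<times> words k))"
      by (rule image_eqI[rotated]) simp
  qed
  then have "card {(p, q) \<in> seeds m k \<times> seeds m k. \<exists>r<R. (fst p, fst q) \<in> torus_edges m ^^ r}
      \<le> card (?near \<times> (words k \<times> words k))"
    using fin finite_words by (intro surj_card_le) auto
  also have "\<dots> = card ?near * 25 ^ k"
    by (simp add: card_cartesian_product card_words power_mult_distrib[symmetric])
  also have "\<dots> \<le> (m * m * 10 ^ R) * 25 ^ k"
    using card_near_pairs_le[of "torus_edges m" 10 "{..<m * m}" R] card_torus_edges[of m]
    by (intro mult_right_mono) auto
  finally show ?thesis .
qed

lemma card_visited_subset_le: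
  assumes "m > 0" "S \<subseteq> {..<m * m}" "real (card S) \<le> 7/10 * real (m * m)"
  shows "real (card {p \<in> seeds m k. visited m p \<subseteq> S}) \<le> real (card (seeds m k)) * exp (- real k / 45000)"
proof -
  have "{p \<in> seeds m k. visited m p \<subseteq> S} = {(v, gs) \<in> {..<m * m} \<times> words k. set (walk m v gs) \<subseteq> S}"
    by (auto simp: seeds_def visited_def)
  then show ?thesis using card_staying_seeds_le[OF assms, of k] by (simp add: card_seeds)
qed

text \<open>Union bound over the pairs (I, J) of block sets met by the two walks, at most 4^M in
  number. For such a pair one set has at most (M + j)/2 blocks, which by \<open>size\<close> cover
  at most 7/10 of the torus, so the walk confined to them pays the exponential factor; the other
  walk is counted trivially.\<close>

lemma card_few_shared_le:
  assumes "m > 0" "m * m \<le> n" "\<sigma> \<in> tours {..<n}" "M > 0"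
    and size: "real ((M + j) * (n div M + 1)) \<le> 14/10 * real (m * m)"
  defines "bl \<equiv> block (n div M + 1) \<sigma>"
  shows "real (card {(p, q) \<in> seeds m k \<times> seeds m k. card (bl ` visited m p \<inter> bl ` visited m q) \<le> j})
    \<le> 4 ^ M * (real (card (seeds m k)))\<^sup>2 * exp (- real k / 45000)"
proof -
  define s where "s = n div M + 1"
  have \<sigma>: "distinct \<sigma>" "set \<sigma> = {..<n}" using assms(3) by (auto simp: tours_def)
  then have length: "length \<sigma> = n" using distinct_card by force
  define S where "S = (\<lambda>I. {v. v < m * m \<and> bl v \<in> I})"
  define A where "A = (\<lambda>I. {p \<in> seeds m k. visited m p \<subseteq> S I})"
  define T where "T = {(I, J). I \<subseteq> {..<M} \<and> J \<subseteq> {..<M} \<and> card (I \<inter> J) \<le> j}"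
  have T_sub: "T \<subseteq> Pow {..<M} \<times> Pow {..<M}" by (auto simp: T_def)
  then have "finite T" by (rule finite_subset) simp
  have "card T \<le> card (Pow {..<M} \<times> Pow {..<M})" using T_sub by (intro card_mono) auto
  also have "\<dots> = 4 ^ M" by (simp add: card_cartesian_product card_Pow power_mult_distrib[symmetric])
  finally have card_T: "card T \<le> 4 ^ M" .
  have finA: "finite (A I)" for I using finite_seeds by (simp add: A_def)
  have A_le: "real (card (A I)) \<le> real (card (seeds m k))" for I
    using finite_seeds by (auto simp: A_def intro!: card_mono)
  have A_small: "real (card (A I)) \<le> real (card (seeds m k)) * exp (- real k / 45000)"
    if "2 * card I \<le> M + j" "finite I" for I
    unfolding A_def
  proof (rule card_visited_subset_le[OF \<open>m > 0\<close>])
    show "S I \<subseteq> {..<m * m}" by (auto simp: S_def)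
    have "card (S I) \<le> card {v \<in> set \<sigma>. bl v \<in> I}"
    proof (rule card_mono)
      show "S I \<subseteq> {v \<in> set \<sigma>. bl v \<in> I}"
        unfolding S_def \<sigma>(2) using less_le_trans[OF _ \<open>m * m \<le> n\<close>] by blast
    qed simp
    also have "\<dots> \<le> card I * s"
      unfolding bl_def s_def by (rule card_blocks_le[OF \<sigma>(1) _ that(2)]) simp
    finally have "2 * card (S I) \<le> 2 * card I * s" by simp
    also have "\<dots> \<le> (M + j) * s" using that by (intro mult_right_mono) auto
    finally have "real (2 * card (S I)) \<le> 14/10 * real (m * m)"
      using size unfolding s_def by (elim order_trans[OF of_nat_mono])
    then show "real (card (S I)) \<le> 7/10 * real (m * m)" by simp
  qed
  have pair: "real (card (A I \<times> A J)) \<le> (real (card (seeds m k)))\<^sup>2 * exp (- real k / 45000)"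
    if "(I, J) \<in> T" for I J
  proof -
    have IJ: "I \<subseteq> {..<M}" "J \<subseteq> {..<M}" "card (I \<inter> J) \<le> j" using that by (auto simp: T_def)
    then have fin: "finite I" "finite J" by (auto intro: finite_subset)
    have "card (I \<union> J) \<le> card {..<M}" using IJ by (intro card_mono) auto
    \<comment> \<open>The sizes of \<open>I\<close> and \<open>J\<close> add up to those of their
      union and intersection, hence to at most M + j.\<close>
    with card_Un_Int[OF fin] IJ(3) have "2 * card I \<le> M + j \<or> 2 * card J \<le> M + j" by auto
    then show ?thesis
    proof
      assume "2 * card I \<le> M + j"
      then have "real (card (A I)) * real (card (A J))
          \<le> (real (card (seeds m k)) * exp (- real k / 45000)) * real (card (seeds m k))"
        using A_small fin A_le by (intro mult_mono) auto
      then show ?thesis by (simp add: card_cartesian_product power2_eq_square mult_ac)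
    next
      assume "2 * card J \<le> M + j"
      then have "real (card (A I)) * real (card (A J))
          \<le> real (card (seeds m k)) * (real (card (seeds m k)) * exp (- real k / 45000))"
        using A_small fin A_le by (intro mult_mono) auto
      then show ?thesis by (simp add: card_cartesian_product power2_eq_square mult_ac)
    qed
  qed
  have bl_less: "bl v < M" if "v < n" for v
  proof -
    have "v \<in> set \<sigma>" using that \<sigma>(2) by simp
    then obtain i where "i < n" "v = \<sigma> ! i" unfolding in_set_conv_nth length by blast
    \<comment> \<open>Adding 1 to the quotient in the block size keeps all block numbers below
      \<open>M\<close>.\<close>
    moreover have "n < M * s"
      using dividend_less_times_div[OF \<open>M > 0\<close>, of n] by (simp add: s_def)
    ultimately have "i div s < M" by (intro less_mult_imp_div_less) simp
    moreover have "bl v = i div s"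
      using block_nth[OF \<sigma>(1), of i s] \<open>i < n\<close> \<open>v = \<sigma> ! i\<close> by (simp add: bl_def s_def length)
    ultimately show ?thesis by simp
  qed
  have cover: "{(p, q) \<in> seeds m k \<times> seeds m k. card (bl ` visited m p \<inter> bl ` visited m q) \<le> j}
      \<subseteq> (\<Union>(I, J)\<in>T. A I \<times> A J)"
  proof (rule subsetI)
    fix z assume "z \<in> {(p, q) \<in> seeds m k \<times> seeds m k. card (bl ` visited m p \<inter> bl ` visited m q) \<le> j}"
    then obtain p q where z: "z = (p, q)" and pq: "p \<in> seeds m k" "q \<in> seeds m k"
      and le: "card (bl ` visited m p \<inter> bl ` visited m q) \<le> j" by blast
    have mem: "t \<in> A (bl ` visited m t)" "bl ` visited m t \<subseteq> {..<M}" if "t \<in> seeds m k" for t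
    proof -
      show "t \<in> A (bl ` visited m t)" using that visited_subset[OF that] unfolding A_def S_def by blast
      show "bl ` visited m t \<subseteq> {..<M}"
      proof (rule image_subsetI)
        fix v assume "v \<in> visited m t"
        then have "v < m * m" using visited_subset[OF that] by blast
        with \<open>m * m \<le> n\<close> have "v < n" by (rule less_le_trans[rotated])
        then show "bl v \<in> {..<M}" using bl_less by simp
      qed
    qed
    have "(bl ` visited m p, bl ` visited m q) \<in> T"
      using le mem(2)[OF pq(1)] mem(2)[OF pq(2)] unfolding T_def by blast
    then show "z \<in> (\<Union>(I, J)\<in>T. A I \<times> A J)"
      using mem(1)[OF pq(1)] mem(1)[OF pq(2)] unfolding z by blast
  qed
  have "card {(p, q) \<in> seeds m k \<times> seeds m k. card (bl ` visited m p \<inter> bl ` visited m q) \<le> j}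
      \<le> card (\<Union>(I, J)\<in>T. A I \<times> A J)"
    using finA \<open>finite T\<close> by (intro card_mono cover) auto
  also have "\<dots> \<le> (\<Sum>z\<in>T. card (case z of (I, J) \<Rightarrow> A I \<times> A J))"
    by (rule card_UN_le[OF \<open>finite T\<close>])
  finally have "real (card {(p, q) \<in> seeds m k \<times> seeds m k. card (bl ` visited m p \<inter> bl ` visited m q) \<le> j})
      \<le> (\<Sum>z\<in>T. real (card (case z of (I, J) \<Rightarrow> A I \<times> A J)))"
    by (simp flip: of_nat_sum)
  also have "\<dots> \<le> (\<Sum>z\<in>T. (real (card (seeds m k)))\<^sup>2 * exp (- real k / 45000))"
    using pair by (intro sum_mono) auto
  also have "\<dots> \<le> 4 ^ M * ((real (card (seeds m k)))\<^sup>2 * exp (- real k / 45000))"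
    using of_nat_mono[OF card_T, where 'a = real] by (simp add: mult_right_mono)
  finally show ?thesis by (simp add: mult.assoc)
qed

text \<open>The sum over \<Omega> of the probabilities is the expected number of bad \<omega>, which
  is bounded tour by tour; so not every probability can exceed \<open>p\<close>.\<close>

lemma averaging:
  fixes D :: "'a pmf"
  assumes "finite \<Omega>" "\<Omega> \<noteq> {}"
    and bound: "\<And>\<sigma>. \<sigma> \<in> set_pmf D \<Longrightarrow> real (card {\<omega> \<in> \<Omega>. Q \<sigma> \<omega>}) \<le> p * real (card \<Omega>)"
  shows "\<exists>\<omega>\<in>\<Omega>. measure_pmf.prob D {\<sigma>. Q \<sigma> \<omega>} \<le> p"
proof (rule ccontr)
  assume "\<not> ?thesis"
  then have gt: "measure_pmf.prob D {\<sigma>. Q \<sigma> \<omega>} > p" if "\<omega> \<in> \<Omega>" for \<omega> using that by force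
  have int: "integrable (measure_pmf D) (indicator {\<sigma>. Q \<sigma> \<omega>} :: 'a \<Rightarrow> real)" for \<omega>
    by (rule measure_pmf.integrable_const_bound[of _ 1]) auto
  have "p * real (card \<Omega>) = (\<Sum>\<omega>\<in>\<Omega>. p)" by simp
  also have "\<dots> < (\<Sum>\<omega>\<in>\<Omega>. measure_pmf.prob D {\<sigma>. Q \<sigma> \<omega>})"
    using assms gt by (intro sum_strict_mono) auto
  also have "\<dots> = (\<Sum>\<omega>\<in>\<Omega>. measure_pmf.expectation D (indicator {\<sigma>. Q \<sigma> \<omega>}))" by simp
  also have "\<dots> = measure_pmf.expectation D (\<lambda>\<sigma>. \<Sum>\<omega>\<in>\<Omega>. indicator {\<sigma>. Q \<sigma> \<omega>} \<sigma>)"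
    using int by (intro Bochner_Integration.integral_sum[symmetric])
  also have "\<dots> \<le> p * real (card \<Omega>)"
  proof (rule measure_pmf.integral_le_const)
    show "AE \<sigma> in measure_pmf D. (\<Sum>\<omega>\<in>\<Omega>. indicator {\<sigma>. Q \<sigma> \<omega>} \<sigma>) \<le> p * real (card \<Omega>)"
      using bound assms(1) by (auto simp: AE_measure_pmf_iff indicator_def sum.If_cases Int_def)
  qed (use int in auto)
  finally show False by simp
qed

section \<open>The lower bound\<close>

text \<open>The two terms bounded by \<open>p\<close> are the proportions of pairs with close
  starting points and of pairs sharing at most \<open>j\<close> blocks. For any other pair the tour
  costs at least k (j + 1) while the optimum is at most 5 k, which explains the condition on
  \<gamma>.\<close>

lemma hard_instance:
  fixes D :: "nat list pmf" and \<gamma> p :: real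
  assumes pos: "m > 0" "k > 0" "M > 0" and "m * m \<le> n"
    and size: "real ((M + j) * (n div M + 1)) \<le> 14/10 * real (m * m)"
    and p: "10 ^ (3 * k) / real (m * m) + 4 ^ M * exp (- real k / 45000) \<le> p" "p < 1"
    and \<gamma>: "5 * \<gamma> < real (j + 1)"
    and D: "set_pmf D \<subseteq> tours {..<n}"
  defines "c \<equiv> \<lambda>u v. real (capped_dist (torus_edges m) k u v)"
  shows "\<exists>X \<subseteq> {..<n}. j + 1 \<le> card X \<and> card X \<le> 2 * (k + 1) \<and>
    measure_pmf.prob D {\<sigma>. tour_cost c r (restrict_tour \<sigma> X) \<le> \<gamma> * opt_tsp c r X} \<le> p"
proof -
  let ?E = "torus_edges m"
  define bl :: "nat list \<Rightarrow> nat \<Rightarrow> nat" where "bl = block (n div M + 1)"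
  define near :: "(nat \<times> nat list) \<times> (nat \<times> nat list) \<Rightarrow> bool" where "near = (\<lambda>(p, q). \<exists>i<3 * k. (fst p, fst q) \<in> ?E ^^ i)"
  define few where "few = (\<lambda>\<sigma> (p, q). card (bl \<sigma> ` visited m p \<inter> bl \<sigma> ` visited m q) \<le> j)"
  let ?\<Omega> = "seeds m k \<times> seeds m k"
  have fin: "finite ?\<Omega>" using finite_seeds by simp
  have card_pos: "real (card (seeds m k)) > 0" using pos by (simp add: card_seeds)
  have card_\<Omega>: "real (card ?\<Omega>) = (real (card (seeds m k)))\<^sup>2"
    by (simp add: card_cartesian_product power2_eq_square)
  have "?\<Omega> \<noteq> {}" using card_pos by auto
  have "real (card {\<omega> \<in> ?\<Omega>. near \<omega> \<or> few \<sigma> \<omega>}) \<le> p * real (card ?\<Omega>)" if "\<sigma> \<in> set_pmf D" for \<sigma>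
  proof -
    have "{\<omega> \<in> ?\<Omega>. near \<omega>} = {(p, q) \<in> ?\<Omega>. \<exists>i<3 * k. (fst p, fst q) \<in> ?E ^^ i}"
      unfolding near_def by blast
    then have "card {\<omega> \<in> ?\<Omega>. near \<omega>} \<le> m * m * 10 ^ (3 * k) * 25 ^ k"
      using card_near_seeds_le[of m k "3 * k"] by simp
    then have "real (card {\<omega> \<in> ?\<Omega>. near \<omega>}) \<le> real (m * m * 10 ^ (3 * k) * 25 ^ k)"
      by (simp only: of_nat_le_iff)
    also have "\<dots> = 10 ^ (3 * k) / real (m * m) * real (card ?\<Omega>)"
    proof -
      have "(25::real) ^ k = 5 ^ k * 5 ^ k" by (simp add: power_mult_distrib[symmetric])
      then show ?thesis unfolding card_\<Omega> card_seeds using pos by (simp add: power2_eq_square)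
    qed
    finally have n1: "real (card {\<omega> \<in> ?\<Omega>. near \<omega>}) \<le> 10 ^ (3 * k) / real (m * m) * real (card ?\<Omega>)" .
    have "{\<omega> \<in> ?\<Omega>. few \<sigma> \<omega>} = {(p, q) \<in> ?\<Omega>. card (bl \<sigma> ` visited m p \<inter> bl \<sigma> ` visited m q) \<le> j}"
      unfolding few_def by blast
    moreover have "\<sigma> \<in> tours {..<n}" using that D by blast
    ultimately have n2: "real (card {\<omega> \<in> ?\<Omega>. few \<sigma> \<omega>}) \<le> 4 ^ M * exp (- real k / 45000) * real (card ?\<Omega>)"
      using card_few_shared_le[OF pos(1) \<open>m * m \<le> n\<close> _ pos(3) size, of \<sigma> k]
      unfolding card_\<Omega> bl_def by (simp add: mult_ac)
    have "{\<omega> \<in> ?\<Omega>. near \<omega> \<or> few \<sigma> \<omega>} = {\<omega> \<in> ?\<Omega>. near \<omega>} \<union> {\<omega> \<in> ?\<Omega>. few \<sigma> \<omega>}" by blast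
    then have "card {\<omega> \<in> ?\<Omega>. near \<omega> \<or> few \<sigma> \<omega>} \<le> card {\<omega> \<in> ?\<Omega>. near \<omega>} + card {\<omega> \<in> ?\<Omega>. few \<sigma> \<omega>}"
      by (simp add: card_Un_le)
    then have "real (card {\<omega> \<in> ?\<Omega>. near \<omega> \<or> few \<sigma> \<omega>})
        \<le> real (card {\<omega> \<in> ?\<Omega>. near \<omega>}) + real (card {\<omega> \<in> ?\<Omega>. few \<sigma> \<omega>})" by linarith
    also have "\<dots> \<le> (10 ^ (3 * k) / real (m * m) + 4 ^ M * exp (- real k / 45000)) * real (card ?\<Omega>)"
      using n1 n2 unfolding distrib_right by (rule add_mono)
    also have "\<dots> \<le> p * real (card ?\<Omega>)" using p(1) by (rule mult_right_mono) simp
    finally show ?thesis .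
  qed
  then have "\<exists>\<omega>\<in>?\<Omega>. measure_pmf.prob D {\<sigma>. near \<omega> \<or> few \<sigma> \<omega>} \<le> p"
    by (rule averaging[OF fin \<open>?\<Omega> \<noteq> {}\<close>])
  then obtain \<omega> where
    \<omega>: "\<omega> \<in> ?\<Omega>" "measure_pmf.prob D {\<sigma>. near \<omega> \<or> few \<sigma> \<omega>} \<le> p" by blast
  obtain a b where ab: "\<omega> = (a, b)" "a \<in> seeds m k" "b \<in> seeds m k" using \<omega>(1) by blast
  define X where "X = visited m a \<union> visited m b"
  \<comment> \<open>Since \<open>near\<close> does not depend on the tour, a single tour outside the
    event, which exists because p < 1, shows that the pair is far apart. The same tour has more than
    \<open>j\<close> shared blocks, which bounds the size of \<open>X\<close> from below.\<close>
  have "\<exists>\<sigma>\<in>set_pmf D. \<not> (near \<omega> \<or> few \<sigma> \<omega>)"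
  proof (rule ccontr)
    assume "\<not> ?thesis"
    then have "AE \<sigma> in measure_pmf D. \<sigma> \<in> {\<sigma>. near \<omega> \<or> few \<sigma> \<omega>}" by (auto simp: AE_measure_pmf_iff)
    then have "measure_pmf.prob D {\<sigma>. near \<omega> \<or> few \<sigma> \<omega>} = 1" by (subst measure_pmf.prob_eq_1) auto
    with \<omega>(2) p(2) show False by simp
  qed
  then obtain \<sigma>0 where \<sigma>0: "\<not> near \<omega>" "\<not> few \<sigma>0 \<omega>" by blast
  have "{..<m * m} \<subseteq> {..<n}" using \<open>m * m \<le> n\<close> by simp
  then have X_sub: "X \<subseteq> {..<n}"
    using visited_subset[OF ab(2)] visited_subset[OF ab(3)] unfolding X_def by (meson Un_least order_trans)
  have finX: "finite X" using finite_visited by (simp add: X_def)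
  have "j + 1 \<le> card (bl \<sigma>0 ` visited m a \<inter> bl \<sigma>0 ` visited m b)" using \<sigma>0(2) by (simp add: few_def ab)
  also have "\<dots> \<le> card (bl \<sigma>0 ` X)" using finX by (intro card_mono) (auto simp: X_def)
  also have "\<dots> \<le> card X" using finX by (rule card_image_le)
  finally have lower: "j + 1 \<le> card X" .
  have upper: "card X \<le> 2 * (k + 1)"
    using card_Un_le[of "visited m a" "visited m b"] card_visited_le[OF ab(2)] card_visited_le[OF ab(3)]
    by (simp add: X_def)
  have far: "capped_dist ?E k u v = k" if "u \<in> visited m a" "v \<in> visited m b" for u v
    using \<sigma>0(1) ab(2,3) that
    by (intro walks_far_apart[of k "fst a" "fst b" m "snd a" "snd b"])
       (auto simp: near_def ab(1) visited_def seeds_def)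
  have opt: "0 \<le> opt_tsp c r X" "opt_tsp c r X \<le> 5 * real k"
  proof -
    show "0 \<le> opt_tsp c r X" by (rule opt_tsp_nonneg[OF _ finX]) (simp add: c_def)
    show "opt_tsp c r X \<le> 5 * real k"
      using opt_tsp_walks_le[of "fst a" m "fst b" "snd a" k "snd b" r] ab(2,3) pos(2)
      unfolding c_def X_def visited_def seeds_def by (simp add: mem_Times_iff)
  qed
  have "few \<sigma> \<omega>" if "\<sigma> \<in> set_pmf D" and cheap: "tour_cost c r (restrict_tour \<sigma> X) \<le> \<gamma> * opt_tsp c r X" for \<sigma>
  proof (rule ccontr)
    assume "\<not> few \<sigma> \<omega>"
    then have "real (j + 1) \<le> real (card (bl \<sigma> ` visited m a \<inter> bl \<sigma> ` visited m b))" by (simp add: few_def ab)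
    then have "real k * real (j + 1) \<le> real k * real (card (bl \<sigma> ` visited m a \<inter> bl \<sigma> ` visited m b))"
      by (rule mult_left_mono) simp
    also have "\<dots> \<le> tour_cost c r (restrict_tour \<sigma> X)"
      unfolding c_def X_def bl_def
    proof (rule tour_cost_ge_shared[OF sym_torus_edges pos(2) _ _ far])
      have "\<sigma> \<in> tours {..<n}" using that D by blast
      then show "distinct \<sigma>" "visited m a \<union> visited m b \<subseteq> set \<sigma>"
        using X_sub by (auto simp: tours_def X_def)
    qed
    also have "\<dots> \<le> \<gamma> * opt_tsp c r X" by (rule cheap)
    \<comment> \<open>The maximum with 0 covers negative values of \<gamma>, for which the upper
      bound on the optimum could not be multiplied through.\<close>
    also have "\<dots> \<le> max \<gamma> 0 * (5 * real k)"
      using opt by (intro mult_mono) auto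
    also have "\<dots> = real k * (5 * max \<gamma> 0)" by simp
    also have "\<dots> < real k * real (j + 1)"
      using \<gamma> pos(2) by (intro mult_strict_left_mono) (auto simp: max_def)
    finally show False by simp
  qed
  then have "measure_pmf.prob D {\<sigma>. tour_cost c r (restrict_tour \<sigma> X) \<le> \<gamma> * opt_tsp c r X}
      \<le> measure_pmf.prob D {\<sigma>. near \<omega> \<or> few \<sigma> \<omega>}"
    by (intro measure_pmf.finite_measure_mono_AE) (auto simp: AE_measure_pmf_iff)
  with \<omega>(2) X_sub lower upper show ?thesis by (intro exI[of _ X]) auto
qed

section \<open>Choice of the parameters\<close>

lemma nat_floor_bounds:
  assumes "x \<ge> 0" shows "real (nat \<lfloor>x\<rfloor>) \<le> x" "x - 1 < real (nat \<lfloor>x\<rfloor>)"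
proof -
  have "real (nat \<lfloor>x\<rfloor>) = of_int \<lfloor>x\<rfloor>" using assms by simp
  then show "real (nat \<lfloor>x\<rfloor>) \<le> x" "x - 1 < real (nat \<lfloor>x\<rfloor>)" by linarith+
qed

lemma of_nat_div_bounds:
  fixes a b :: nat
  assumes "b > 0" shows "real (a div b) \<le> real a / real b" "real a / real b - 1 < real (a div b)"
  using floor_divide_of_nat_eq[of a b, where 'a = real] by linarith+

definition torus_side :: "nat \<Rightarrow> nat" where
  "torus_side n = nat \<lfloor>sqrt (real n)\<rfloor>"

text \<open>With divisor 20, n >= exp(20 k), which beats the ball size 10^(3 k) <= exp(9 k) by a
  factor exp(11 k). Neither this length nor the torus side depends on the function \<gamma>, so the
  metric can be fixed before it.\<close>

definition walk_length :: "nat \<Rightarrow> nat" where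
  "walk_length n = nat \<lfloor>ln (real n) / 20\<rfloor>"

text \<open>\<open>M\<close> is so small a fraction of \<open>k\<close> that 4^M consumes less than
  half of the decay exp(-k/45000). With \<open>j\<close> at most M/10, half of M + j blocks are
  about 55 percent of the points, which leaves room below 70 percent for rounding. The target rate
  1/10^6 per element of \<open>X\<close> is slower than the remaining decay, and the slack absorbs
  the constants.\<close>

lemma eventually_hard_parameters:
  fixes \<gamma> :: "nat \<Rightarrow> real"
  assumes "\<gamma> \<in> o(\<lambda>n. ln (real n))"
  defines "m \<equiv> torus_side" and "k \<equiv> walk_length"
  defines "M \<equiv> \<lambda>n. k n div 200000"
  defines "j \<equiv> \<lambda>n. M n div 10"
  shows "\<forall>\<^sub>F n in sequentially. m n > 0 \<and> k n > 0 \<and> M n > 0 \<and> m n * m n \<le> n \<and>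
    real ((M n + j n) * (n div M n + 1)) \<le> 14/10 * real (m n * m n) \<and>
    10 ^ (3 * k n) / real (m n * m n) + 4 ^ M n * exp (- real (k n) / 45000)
      \<le> 1/2 * exp (- (1/10^6) * real (2 * (k n + 1))) \<and>
    5 * \<gamma> n < real (j n + 1) \<and>
    1/10^8 * ln (real n) \<le> real (j n + 1) \<and> real (2 * (k n + 1)) \<le> ln (real n)"
proof -
  \<comment> \<open>Five times 1/10^9 stays below the 1/10^8 that bounds \<open>j + 1\<close> from
    below.\<close>
  have "\<forall>\<^sub>F n in sequentially. \<bar>\<gamma> n\<bar> \<le> 1/10^9 * \<bar>ln (real n)\<bar>"
    using landau_o.smallD[OF assms(1), of "1/10^9"] by simp
  \<comment> \<open>Large enough for the roundings in \<open>k\<close>, \<open>M\<close> and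
    \<open>j\<close> to cost only a constant factor.\<close>
  moreover have "\<forall>\<^sub>F n in sequentially. ln (real n) \<ge> 10 ^ 9"
    by real_asymp
  \<comment> \<open>Here sqrt n - 1 is the lower bound for the rounded torus side.\<close>
  moreover have "\<forall>\<^sub>F n in sequentially. 11/10 * (real n + ln (real n)) \<le> 14/10 * (sqrt (real n) - 1)\<^sup>2"
    by real_asymp
  moreover have "\<forall>\<^sub>F n in sequentially. 4 * exp (- 11 * (ln (real n) / 20 - 1)) + exp (- (ln (real n) / 20 - 1) / 90000)
      \<le> 1/2 * exp (- (1/10^6) * (2 * (ln (real n) / 20 + 1)))"
    by real_asymp
  moreover have "\<forall>\<^sub>F n in sequentially. real n / 4 \<le> (sqrt (real n) - 1)\<^sup>2"
    by real_asymp
  moreover have "\<forall>\<^sub>F n in sequentially. (1::real) < sqrt (real n)"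
    by real_asymp
  ultimately show ?thesis
  proof eventually_elim
    case (elim n)
    define l where "l = ln (real n)"
    have l: "l \<ge> 10 ^ 9" using elim l_def by simp
    have n: "real n > 0" "real n = exp l" using elim(6) by (auto simp: l_def)
    have k: "real (k n) \<le> l / 20" "l / 20 - 1 < real (k n)"
      using l nat_floor_bounds[of "l / 20"] unfolding k_def walk_length_def l_def[symmetric] by simp_all
    have M: "real (M n) \<le> real (k n) / 200000" "real (k n) / 200000 - 1 < real (M n)"
      unfolding M_def using of_nat_div_bounds[of 200000 "k n"] by simp_all
    have j: "real (j n) \<le> real (M n) / 10" "real (M n) / 10 - 1 < real (j n)"
      unfolding j_def using of_nat_div_bounds[of 10 "M n"] by simp_all
    have m: "real (m n) \<le> sqrt (real n)" "sqrt (real n) - 1 < real (m n)"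
      using nat_floor_bounds[of "sqrt (real n)"] unfolding m_def torus_side_def by simp_all
    have m_sq: "real (m n * m n) \<le> real n" "(sqrt (real n) - 1)\<^sup>2 \<le> real (m n * m n)"
    proof -
      have "(real (m n))\<^sup>2 \<le> (sqrt (real n))\<^sup>2" using m(1) by (intro power_mono) auto
      then show "real (m n * m n) \<le> real n" by (simp add: power2_eq_square)
      have "(sqrt (real n) - 1)\<^sup>2 \<le> (real (m n))\<^sup>2" using m(2) elim(6) by (intro power_mono) auto
      then show "(sqrt (real n) - 1)\<^sup>2 \<le> real (m n * m n)" by (simp add: power2_eq_square)
    qed
    have k_pos: "real (k n) > 0" and M_pos: "real (M n) > 0" using l k M by auto
    have m_pos: "real (m n) > 0" using m(2) elim(6) by linarith
    have "real ((M n + j n) * (n div M n + 1)) \<le> (11/10 * real (M n)) * (real n / real (M n) + 1)"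
      using of_nat_div_bounds(1)[of "M n" n] M_pos j(1) unfolding of_nat_mult of_nat_add
      by (intro mult_mono add_mono) auto
    also have "\<dots> = 11/10 * (real n + real (M n))" using M_pos by (simp add: field_simps)
    also have "\<dots> \<le> 11/10 * (real n + l)" using M k l by simp
    also have "\<dots> \<le> 14/10 * (sqrt (real n) - 1)\<^sup>2" using elim(3) by (simp add: l_def)
    also have "\<dots> \<le> 14/10 * real (m n * m n)" using m_sq(2) by simp
    finally have size: "real ((M n + j n) * (n div M n + 1)) \<le> 14/10 * real (m n * m n)" .
    have "10 ^ (3 * k n) / real (m n * m n) \<le> 4 * exp (- 11 * real (k n))"
    proof -
      have "(10::real) \<le> exp 3"
      proof -
        have "(5/2 :: real) \<le> exp 1" using e_less_272 exp_lower_Taylor_quadratic[of 1] by simp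
        then have "(5/2 :: real) ^ 3 \<le> exp 1 ^ 3" by (rule power_mono) simp
        moreover have "exp (3::real) = exp 1 ^ 3" using exp_of_nat_mult[of 3 "1::real"] by simp
        moreover have "(10::real) \<le> (5/2) ^ 3" by (simp add: power3_eq_cube)
        ultimately show ?thesis by linarith
      qed
      then have "(10::real) ^ (3 * k n) \<le> exp 3 ^ (3 * k n)" by (rule power_mono) simp
      also have "\<dots> = exp (9 * real (k n))" by (simp add: exp_of_nat_mult[symmetric])
      finally have num: "(10::real) ^ (3 * k n) \<le> exp (9 * real (k n))" .
      have "exp (20 * real (k n)) / 4 \<le> real n / 4" using k(1) n(2) by simp
      also have "\<dots> \<le> real (m n * m n)" using elim(5) m_sq(2) by linarith
      finally have den: "exp (20 * real (k n)) / 4 \<le> real (m n * m n)" .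
      have "10 ^ (3 * k n) / real (m n * m n) \<le> exp (9 * real (k n)) / (exp (20 * real (k n)) / 4)"
        using num den by (intro frac_le) auto
      also have "\<dots> = 4 * (exp (9 * real (k n)) / exp (20 * real (k n)))" by simp
      also have "exp (9 * real (k n)) / exp (20 * real (k n)) = exp (- 11 * real (k n))"
        unfolding exp_diff[symmetric] by simp
      finally show ?thesis .
    qed
    also have "\<dots> \<le> 4 * exp (- 11 * (l / 20 - 1))" using k by simp
    finally have p1: "10 ^ (3 * k n) / real (m n * m n) \<le> 4 * exp (- 11 * (l / 20 - 1))" .
    have "(4::real) ^ M n * exp (- real (k n) / 45000) \<le> exp (- real (k n) / 90000)"
    proof -
      have "(4::real) \<le> exp 2"
      proof -
        have "(2 :: real) \<le> exp 1" using exp_ge_add_one_self[of 1] by simp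
        then have "(2 :: real) ^ 2 \<le> exp 1 ^ 2" by (rule power_mono) simp
        moreover have "exp (2::real) = exp 1 ^ 2" using exp_of_nat_mult[of 2 "1::real"] by simp
        ultimately show ?thesis by simp
      qed
      then have "(4::real) ^ M n \<le> exp 2 ^ M n" by (rule power_mono) simp
      also have "\<dots> = exp (2 * real (M n))" by (simp add: exp_of_nat_mult[symmetric] mult.commute)
      finally have "(4::real) ^ M n * exp (- real (k n) / 45000) \<le> exp (2 * real (M n)) * exp (- real (k n) / 45000)"
        by (rule mult_right_mono) simp
      \<comment> \<open>2 M is at most k/100000, hence less than k/90000, half of the available
        exponent.\<close>
      also have "\<dots> \<le> exp (- real (k n) / 90000)"
        unfolding exp_add[symmetric] exp_le_cancel_iff using M(1) k_pos by linarith
      finally show ?thesis .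
    qed
    also have "\<dots> \<le> exp (- (l / 20 - 1) / 90000)" using k by simp
    finally have p2: "4 ^ M n * exp (- real (k n) / 45000) \<le> exp (- (l / 20 - 1) / 90000)" .
    have "1/2 * exp (- (1/10^6) * (2 * (l / 20 + 1))) \<le> 1/2 * exp (- (1/10^6) * real (2 * (k n + 1)))"
      using k(1) by simp
    with p1 p2 elim(4) have p: "10 ^ (3 * k n) / real (m n * m n) + 4 ^ M n * exp (- real (k n) / 45000)
      \<le> 1/2 * exp (- (1/10^6) * real (2 * (k n + 1)))" unfolding l_def by linarith
    have jl: "1/10^8 * l \<le> real (j n + 1)" using j M k l by simp
    have "5 * \<gamma> n < real (j n + 1)" using elim(1) jl l unfolding l_def[symmetric] by simp
    moreover have "real (2 * (k n + 1)) \<le> l" using k l by simp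
    moreover have "m n * m n \<le> n" using m_sq(1) by (simp only: of_nat_le_iff)
    ultimately show ?case
      using m_pos k_pos M_pos size p jl unfolding l_def[symmetric] by simp
  qed
qed

text \<open>The event that the cost is o(log n) times the optimum is read as a bound by
  \<open>g n\<close> times the optimum, for an arbitrary \<open>g\<close> of that order. The spaces
  and all constants are chosen before \<open>g\<close>; only the threshold for \<open>n\<close> may
  depend on it.\<close>

theorem theorem9:
  shows "\<exists>(V :: nat \<Rightarrow> nat set) (c :: nat \<Rightarrow> nat \<Rightarrow> nat \<Rightarrow> real) (r :: nat \<Rightarrow> nat)
            (\<epsilon>0 :: real) (a :: real) (b :: real).
     \<epsilon>0 > 0 \<and> 0 < a \<and> a \<le> b \<and>
     (\<forall>\<^sub>F n in sequentially.
        finite (V n) \<and> card (V n) = n \<and> r n \<in> V n \<and> metric_on (V n) (c n)) \<and>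
     (\<forall>g :: nat \<Rightarrow> real. g \<in> o(\<lambda>n. ln (real n)) \<longrightarrow>
        (\<forall>\<^sub>F n in sequentially.
           \<forall>D :: nat list pmf. set_pmf D \<subseteq> tours (V n) \<longrightarrow>
             (\<exists>X \<subseteq> V n. a * ln (real n) \<le> real (card X) \<and> real (card X) \<le> b * ln (real n) \<and>
                measure_pmf.prob D
                  {\<sigma>. tour_cost (c n) (r n) (restrict_tour \<sigma> X) \<le> g n * opt_tsp (c n) (r n) X}
                \<le> 1/2 * exp (- \<epsilon>0 * real (card X)))))"
proof -
  define V :: "nat \<Rightarrow> nat set" where "V = (\<lambda>n. {..<n})"
  define c where "c = (\<lambda>n u v. real (capped_dist (torus_edges (torus_side n)) (walk_length n) u v))"
  \<comment> \<open>\<open>hard_instance\<close> holds for every root, so any vertex will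
    do.\<close>
  define r :: "nat \<Rightarrow> nat" where "r = (\<lambda>n. 0)"
  have metric: "\<forall>\<^sub>F n in sequentially. finite (V n) \<and> card (V n) = n \<and> r n \<in> V n \<and> metric_on (V n) (c n)"
  proof -
    \<comment> \<open>This makes the cap at least 1, so that distinct points have positive
      distance.\<close>
    have "\<forall>\<^sub>F n in sequentially. ln (real n) \<ge> 20" by real_asymp
    moreover have "\<forall>\<^sub>F n in sequentially. n > (0::nat)" by (rule eventually_gt_at_top)
    ultimately show ?thesis
    proof eventually_elim
      case (elim n)
      then have "walk_length n > 0" unfolding walk_length_def by simp
      then show ?case
        using elim metric_on_capped_dist[OF sym_torus_edges] by (simp add: V_def r_def c_def)
    qed
  qed
  have hard: "\<forall>\<^sub>F n in sequentially.
           \<forall>D :: nat list pmf. set_pmf D \<subseteq> tours (V n) \<longrightarrow>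
             (\<exists>X \<subseteq> V n. 1/10^8 * ln (real n) \<le> real (card X) \<and> real (card X) \<le> 1 * ln (real n) \<and>
                measure_pmf.prob D
                  {\<sigma>. tour_cost (c n) (r n) (restrict_tour \<sigma> X) \<le> g n * opt_tsp (c n) (r n) X}
                \<le> 1/2 * exp (- (1/10^6) * real (card X)))"
    if "g \<in> o(\<lambda>n. ln (real n))" for g :: "nat \<Rightarrow> real"
    using eventually_hard_parameters[OF that]
  proof eventually_elim
    case (elim n)
    define k where "k = walk_length n"
    define j where "j = k div 200000 div 10"
    \<comment> \<open>The bound must be fixed before \<open>X\<close> is found, so its size is
      replaced by the maximal value 2 (k + 1).\<close>
    define p where "p = 1/2 * exp (- (1/10^6) * real (2 * (k + 1)))"
    note par = elim[folded k_def, folded j_def p_def]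
    have "exp (- (1/10^6) * real (2 * (k + 1))) \<le> 1" by simp
    then have "p < 1" unfolding p_def by linarith
    show ?case
    proof (intro allI impI)
      fix D :: "nat list pmf" assume "set_pmf D \<subseteq> tours (V n)"
      then have D: "set_pmf D \<subseteq> tours {..<n}" by (simp add: V_def)
      have "\<exists>X \<subseteq> {..<n}. j + 1 \<le> card X \<and> card X \<le> 2 * (k + 1) \<and>
        measure_pmf.prob D {\<sigma>. tour_cost (c n) (r n) (restrict_tour \<sigma> X) \<le> g n * opt_tsp (c n) (r n) X} \<le> p"
        unfolding c_def k_def[symmetric]
        by (rule hard_instance[where M = "k div 200000"]) (use par D \<open>p < 1\<close> in blast)+
      then obtain X where X: "X \<subseteq> {..<n}" "j + 1 \<le> card X" "card X \<le> 2 * (k + 1)"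
        "measure_pmf.prob D {\<sigma>. tour_cost (c n) (r n) (restrict_tour \<sigma> X) \<le> g n * opt_tsp (c n) (r n) X} \<le> p"
        by blast
      have size: "real (j + 1) \<le> real (card X)" "real (card X) \<le> real (2 * (k + 1))"
        using X(2,3) by (simp_all only: of_nat_le_iff)
      then have "p \<le> 1/2 * exp (- (1/10^6) * real (card X))" unfolding p_def by simp
      with X(4) have "measure_pmf.prob D
          {\<sigma>. tour_cost (c n) (r n) (restrict_tour \<sigma> X) \<le> g n * opt_tsp (c n) (r n) X}
          \<le> 1/2 * exp (- (1/10^6) * real (card X))" by (rule order_trans)
      moreover have "1/10^8 * ln (real n) \<le> real (card X)" "real (card X) \<le> 1 * ln (real n)"
        using par size by linarith+
      ultimately show "\<exists>X \<subseteq> V n. 1/10^8 * ln (real n) \<le> real (card X) \<and> real (card X) \<le> 1 * ln (real n) \<and>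
                measure_pmf.prob D
                  {\<sigma>. tour_cost (c n) (r n) (restrict_tour \<sigma> X) \<le> g n * opt_tsp (c n) (r n) X}
                \<le> 1/2 * exp (- (1/10^6) * real (card X))"
        using X(1) unfolding V_def by blast
    qed
  qed
  show ?thesis
    by (rule exI[of _ V], rule exI[of _ c], rule exI[of _ r], rule exI[of _ "1/10^6"],
        rule exI[of _ "1/10^8"], rule exI[of _ 1])
      (intro conjI allI impI metric hard; simp)
qed

end
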